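(* Let $k\geq2$ be an integer. Let $n$ range over the sequence of powers of four. Then \[\mathrm{ex}(n,\boldsymbol{\mathcal{D}}(\mathcal{S}^kC_4))=\left(\frac{1}{k!}+\frac{1}{(k+1)!}\right)n^{k-1/2}+O(n^{k-1}),\] where the implied constant may depend only on $k$.
   Context: For an integer $k\geq2$ and a graph $F$, the $k$-uniform suspension $\mathcal{S}^kF$ is the $k$-uniform hypergraph with vertex set $S\cup V(F)$ and edge set $\{S\cup e:\,e\in E(F)\}$, where $S$ is a set of size $k-2$ disjoint from $V(F)$. $C_4$ is the cycle of length $4$. A $(k-1)$-dimensional (abstract) simplicial complex $\boldsymbol{F}=(V(\boldsymbol{F}),E(\boldsymbol{F}))$ is a non-uniform hypergraph without isolated vertices (every vertex lies in some edge), where $E(\boldsymbol{F})$ is closed under taking subsets (the empty set counts as an edge) and has maximum edge size $k$. A simplicial complex is $\boldsymbol{F}$-free if it contains no (not necessarily induced) subcomplex isomorphic to $\boldsymbol{F}$. $\mathrm{ex}(n,\boldsymbol{F})$ denotes the maximum number of edges in an $n$-vertex $\boldsymbol{F}$-free simplicial complex (of arbitrary dimension). For a $k$-uniform hypergraph $H$ without isolated vertices, $\boldsymbol{\mathcal{D}}(H)$ denotes the $(k-1)$-dimensional simplicial complex obtained by taking the downward closure of $E(H)$, i.e. its edges are all subsets of edges of $H$. *)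

theory Defs
  imports Complex_Main
begin

datatype 'a hypergraph = Hypergraph (verts: "'a set") (edges: "'a set set")

definition cycle_graph :: "nat \<Rightarrow> nat hypergraph" where
  "cycle_graph l = Hypergraph {..<l} {{i, Suc i mod l} | i. i < l}"

text \<open>The sum type makes the \<open>k - 2\<close> new vertices disjoint from the old ones;
  the suspension is intended for \<open>k \<ge> 2\<close>.\<close>

definition suspension :: "nat \<Rightarrow> 'a hypergraph \<Rightarrow> ('a + nat) hypergraph" where
  "suspension k F =
     (let S = Inr ` {..<k - 2}
      in Hypergraph (S \<union> Inl ` verts F) {S \<union> Inl ` e | e. e \<in> edges F})"

definition abstract_complex :: "'a hypergraph \<Rightarrow> bool" where
  "abstract_complex K \<longleftrightarrow>
     finite (verts K) \<and> \<Union>(edges K) = verts K \<and> {} \<in> edges K \<and>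
     (\<forall>e\<in>edges K. \<forall>d. d \<subseteq> e \<longrightarrow> d \<in> edges K)"

definition down_closure :: "'a hypergraph \<Rightarrow> 'a hypergraph" where
  "down_closure H = Hypergraph (verts H) {d. \<exists>e\<in>edges H. d \<subseteq> e}"

definition isomorphic :: "'a hypergraph \<Rightarrow> 'b hypergraph \<Rightarrow> bool" where
  "isomorphic G H \<longleftrightarrow>
     (\<exists>f. bij_betw f (verts G) (verts H) \<and> edges H = (\<lambda>e. f ` e) ` edges G)"

definition subcomplex :: "'a hypergraph \<Rightarrow> 'a hypergraph \<Rightarrow> bool" where
  "subcomplex L K \<longleftrightarrow>
     abstract_complex L \<and> verts L \<subseteq> verts K \<and> edges L \<subseteq> edges K"

definition complex_free :: "'b hypergraph \<Rightarrow> 'a hypergraph \<Rightarrow> bool" where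
  "complex_free F K \<longleftrightarrow> \<not> (\<exists>L. subcomplex L K \<and> isomorphic F L)"

text \<open>Every finite complex is isomorphic to one whose vertices are natural numbers, so
  fixing the vertex type loses nothing. All edges are counted, of every size and including
  the empty one.\<close>

definition ex_complex :: "nat \<Rightarrow> 'b hypergraph \<Rightarrow> nat" where
  "ex_complex n F =
     Max {card (edges K) | K :: nat hypergraph.
            abstract_complex K \<and> card (verts K) = n \<and> complex_free F K}"

end

theory Submission
  imports Defs "HOL-Algebra.Algebraic_Closure_Type" "HOL-Combinatorics.Multiset_Permutations"
    "HOL-Library.Z2" "HOL-Library.Product_Plus"
begin

text \<open>
  A complex is free of the downward closure of \<open>S\<^sup>kC\<^sub>4\<close> iff the link graph of every
  \<open>(k - 2)\<close>-set is \<open>C\<^sub>4\<close>-free. For the upper bound, the Kovari--Sos--Turan count in each link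
  bounds the number of \<open>k\<close>-edges; two \<open>(k + 1)\<close>-edges sharing \<open>k\<close> vertices would create a
  \<open>C\<^sub>4\<close> in some link, so there are at most \<open>1 / (k + 1)\<close> times as many \<open>(k + 1)\<close>-edges as
  \<open>k\<close>-edges, and no larger edges at all.

  For the lower bound let \<open>n = q\<^sup>2\<close> with \<open>q = 2\<^sup>m\<close> and take the plane over the field with \<open>q\<close>
  elements as vertex set. In characteristic two the determinant \<open>det\<close> is symmetric, and the
  \<open>k\<close>-edges are the \<open>k\<close>-sets \<open>e\<close> with \<open>Q(e) = 1\<close>, where \<open>Q(e)\<close> is the sum of \<open>det(u, v)\<close> over
  the pairs in \<open>e\<close>. If \<open>S\<close> has sum \<open>s\<close>, then \<open>Q(S \<union> {a, b}) = Q(S) + det(a + s, b + s)\<close>, so the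
  link of \<open>S\<close> is a translate of a graph \<open>det(a, b) = c\<close>; it is \<open>C\<^sub>4\<close>-free unless \<open>c = 0\<close>, that is,
  unless \<open>Q(S) = 1\<close>. The edges containing such an \<open>S\<close> are discarded; there are only
  \<open>O(n\<^sup>k\<^sup>-\<^sup>1)\<close> of them. Adding its own sum to a set with \<open>Q(e) = 1\<close> yields a zero-sum set with the
  same value of \<open>Q\<close>, all of whose \<open>k\<close>-subsets again have value \<open>1\<close>; these are the
  \<open>(k + 1)\<close>-edges.
\<close>

section \<open>Embeddings of suspensions of the four-cycle\<close>

text \<open>The spine of the suspension is a list, so that a single \<open>distinct\<close>
  expresses its size, its disjointness from the cycle and the four different cycle vertices.\<close>

definition avoids_C4_suspension :: "nat \<Rightarrow> 'a set set \<Rightarrow> bool" where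
  "avoids_C4_suspension k E \<longleftrightarrow>
     (\<nexists>S a b c d. length S = k - 2 \<and> distinct (a # b # c # d # S) \<and>
        {insert a (insert b (set S)), insert b (insert c (set S)),
         insert c (insert d (set S)), insert d (insert a (set S))} \<subseteq> E)"

lemma avoids_C4_suspensionD:
  assumes "avoids_C4_suspension k E" "length S = k - 2" "distinct (a # b # c # d # S)"
    "insert a (insert b (set S)) \<in> E" "insert b (insert c (set S)) \<in> E"
    "insert c (insert d (set S)) \<in> E" "insert d (insert a (set S)) \<in> E"
  shows False
proof -
  have "{insert a (insert b (set S)), insert b (insert c (set S)),
         insert c (insert d (set S)), insert d (insert a (set S))} \<subseteq> E"
    using assms(4-7) by simp
  thus False
    using assms(1-3) unfolding avoids_C4_suspension_def by metis
qed

text \<open>Since \<open>K\<close> is closed under subsets, an injection sending the edges of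
  \<open>H\<close> into \<open>K\<close> sends all their subsets there too, and the image of the
  closure is a subcomplex. Copies of the closure thus reduce to embeddings of
  \<open>H\<close>.\<close>

lemma complex_free_iff_embedding:
  assumes "abstract_complex K" "finite (verts H)" "\<Union>(edges H) = verts H" "edges H \<noteq> {}"
  shows "complex_free (down_closure H) K \<longleftrightarrow>
    (\<nexists>f. inj_on f (verts H) \<and> (\<forall>e\<in>edges H. f ` e \<in> edges K))"
proof -
  have "(\<exists>L. subcomplex L K \<and> isomorphic (down_closure H) L)
    \<longleftrightarrow> (\<exists>f. inj_on f (verts H) \<and> (\<forall>e\<in>edges H. f ` e \<in> edges K))" (is "?l \<longleftrightarrow> ?r")
  proof
    assume ?l
    then obtain L f where L: "subcomplex L K" "bij_betw f (verts H) (verts L)"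
        "edges L = (\<lambda>e. f ` e) ` {d. \<exists>e\<in>edges H. d \<subseteq> e}"
      by (auto simp: isomorphic_def down_closure_def)
    have "f ` e \<in> edges K" if "e \<in> edges H" for e
    proof -
      have "f ` e \<in> edges L"
        using that L(3) by blast
      thus ?thesis
        using L(1) by (auto simp: subcomplex_def)
    qed
    thus ?r
      using L(2) by (auto simp: bij_betw_def)
  next
    assume ?r
    then obtain f where f: "inj_on f (verts H)" "\<And>e. e \<in> edges H \<Longrightarrow> f ` e \<in> edges K"
      by blast
    define L where "L = Hypergraph (f ` verts H) ((\<lambda>e. f ` e) ` edges (down_closure H))"
    have sub: "edges L \<subseteq> edges K"
    proof
      fix x assume "x \<in> edges L"
      then obtain d e where "e \<in> edges H" "d \<subseteq> e" "x = f ` d"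
        by (auto simp: L_def down_closure_def)
      thus "x \<in> edges K"
        using assms(1) f(2)[of e] image_mono[of d e f] by (auto simp: abstract_complex_def)
    qed
    have "\<Union>{d. \<exists>e\<in>edges H. d \<subseteq> e} = verts H"
      using assms(3) by blast
    hence union: "\<Union>(edges L) = verts L"
      by (simp add: L_def down_closure_def flip: image_Union)
    have down: "d \<in> edges L" if de: "e \<in> edges L" "d \<subseteq> e" for d e
    proof -
      obtain e1 e2 where e: "e2 \<in> edges H" "e1 \<subseteq> e2" "e = f ` e1"
        using de by (auto simp: L_def down_closure_def)
      obtain d1 where "d1 \<subseteq> e1" "d = f ` d1"
        using de(2) e(3) by (auto simp: subset_image_iff)
      thus ?thesis
        using e by (auto simp: L_def down_closure_def)
    qed
    have empty: "{} \<in> edges L"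
      using assms(4) down by (auto simp: L_def down_closure_def)
    have "verts L \<subseteq> verts K"
      using sub union assms(1) unfolding abstract_complex_def by (metis Union_mono)
    hence "subcomplex L K"
      using sub union down empty assms(2)
      unfolding subcomplex_def abstract_complex_def by (auto simp: L_def)
    moreover have "isomorphic (down_closure H) L"
      unfolding isomorphic_def
      by (rule exI[of _ f]) (use f(1) in \<open>auto simp: L_def down_closure_def bij_betw_def\<close>)
    ultimately show ?l
      by blast
  qed
  thus ?thesis
    by (simp add: complex_free_def)
qed

lemma edges_cycle_graph_4: "edges (cycle_graph 4) = {{0, 1}, {1, 2}, {2, 3}, {3, 0}}"
proof -
  have "edges (cycle_graph 4) = (\<lambda>i. {i, Suc i mod 4}) ` {i. i < 4}"
    by (auto simp: cycle_graph_def)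
  also have "{i :: nat. i < 4} = {0, 1, 2, 3}"
    by auto
  also have "(\<lambda>i. {i, Suc i mod 4}) ` {0, 1, 2, 3}
    = {{0, Suc 0 mod 4}, {1, Suc 1 mod 4}, {2, Suc 2 mod 4}, {3, Suc 3 mod 4}}"
    by (simp only: image_insert image_empty)
  finally have eq: "edges (cycle_graph 4)
    = {{0, Suc 0 mod 4}, {1, Suc 1 mod 4}, {2, Suc 2 mod 4}, {3, Suc 3 mod 4}}" .
  have "Suc 0 mod 4 = 1" "Suc 1 mod 4 = 2" "Suc 2 mod 4 = 3" "Suc 3 mod 4 = 0"
    by simp_all
  thus ?thesis
    by (simp only: eq)
qed

text \<open>An embedding of the suspension is a labelling: the images of the \<open>k - 2\<close>
  added vertices, listed in order, form \<open>S\<close>, and the images of the cycle vertices are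
  \<open>a\<close>, \<open>b\<close>, \<open>c\<close>, \<open>d\<close>.\<close>

lemma complex_free_C4_suspension_iff:
  assumes "abstract_complex K"
  shows "complex_free (down_closure (suspension k (cycle_graph 4))) K
    \<longleftrightarrow> avoids_C4_suspension k (edges K)"
proof -
  define H where "H = suspension k (cycle_graph 4)"
  define I where "I = (Inr ` {..<k - 2} :: (nat + nat) set)"
  have verts_H: "verts H = I \<union> Inl ` {0, 1, 2, 3}"
    by (auto simp: H_def I_def suspension_def cycle_graph_def)
  have edges_H: "edges H = {I \<union> {Inl 0, Inl 1}, I \<union> {Inl 1, Inl 2}, I \<union> {Inl 2, Inl 3},
      I \<union> {Inl 3, Inl 0}}"
  proof -
    have "edges H = (\<lambda>e. I \<union> Inl ` e) ` edges (cycle_graph 4)"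
      by (auto simp: H_def I_def suspension_def)
    thus ?thesis
      by (simp add: edges_cycle_graph_4)
  qed
  have "(\<exists>f. inj_on f (verts H) \<and> (\<forall>e\<in>edges H. f ` e \<in> edges K))
    \<longleftrightarrow> \<not> avoids_C4_suspension k (edges K)" (is "?l \<longleftrightarrow> ?r")
  proof
    assume ?l
    then obtain f where f: "inj_on f (verts H)" "\<forall>e\<in>edges H. f ` e \<in> edges K"
      by blast
    define S where "S = map (\<lambda>i. f (Inr i)) [0..<k - 2]"
    have set_S: "set S = f ` I"
      by (auto simp: S_def I_def image_image)
    have "distinct S"
      using f(1) by (auto simp: S_def distinct_map verts_H I_def inj_on_def)
    moreover have "length S = k - 2"
      by (simp add: S_def)
    moreover have "distinct (f (Inl 0) # f (Inl 1) # f (Inl 2) # f (Inl 3) # S)"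
      using f(1) \<open>distinct S\<close> by (auto simp: set_S verts_H I_def inj_on_def)
    moreover have "{insert (f (Inl 0)) (insert (f (Inl 1)) (set S)),
        insert (f (Inl 1)) (insert (f (Inl 2)) (set S)),
        insert (f (Inl 2)) (insert (f (Inl 3)) (set S)),
        insert (f (Inl 3)) (insert (f (Inl 0)) (set S))} \<subseteq> edges K"
      using f(2) by (simp add: edges_H set_S image_Un)
    ultimately show ?r
      using avoids_C4_suspensionD[of k "edges K" S "f (Inl 0)" "f (Inl 1)" "f (Inl 2)" "f (Inl 3)"]
      by auto
  next
    assume ?r
    then obtain S a b c d where S: "length S = k - 2" "distinct (a # b # c # d # S)"
      "{insert a (insert b (set S)), insert b (insert c (set S)),
        insert c (insert d (set S)), insert d (insert a (set S))} \<subseteq> edges K"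
      unfolding avoids_C4_suspension_def not_not by (elim exE conjE) (rule that)
    define f where "f = case_sum (\<lambda>i. [a, b, c, d] ! i) (\<lambda>i. S ! i)"
    have fI: "f ` I = set S"
      using S(1) by (auto simp: I_def f_def set_conv_nth image_iff)
    have f: "f (Inl 0) = a" "f (Inl 1) = b" "f (Inl 2) = c" "f (Inl 3) = d"
      by (simp_all add: f_def)
    have injI: "inj_on f I"
      using S(1,2) by (auto simp: I_def f_def inj_on_def nth_eq_iff_index_eq)
    have "inj_on f (verts H)"
      unfolding verts_H inj_on_Un
    proof (intro conjI)
      show "inj_on f (Inl ` {0, 1, 2, 3})"
        using S(2) by (auto simp: f inj_on_def f_def)
      have "f ` Inl ` {0, 1, 2, 3} = {a, b, c, d}"
        by (simp add: f del: One_nat_def)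
      hence "f ` I \<inter> f ` Inl ` {0, 1, 2, 3} = {}"
        using S(2) fI by auto
      thus "f ` (I - Inl ` {0, 1, 2, 3}) \<inter> f ` (Inl ` {0, 1, 2, 3} - I) = {}"
        by blast
    qed (rule injI)
    moreover have "\<forall>e\<in>edges H. f ` e \<in> edges K"
      using S(3) by (simp add: edges_H image_Un fI f del: One_nat_def)
    ultimately show ?l
      by blast
  qed
  moreover have "finite (verts H)" "\<Union>(edges H) = verts H" "edges H \<noteq> {}"
    by (auto simp: verts_H edges_H I_def)
  ultimately show ?thesis
    using complex_free_iff_embedding[OF assms, of H] by (simp add: H_def)
qed

section \<open>The upper bound\<close>

text \<open>A \<open>k\<close>-set has \<open>k!\<close> orderings. Both bounds count ordered edges,
  and this is where the factorials in the leading coefficient arise.\<close>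

lemma card_distinct_lists_family:
  assumes "finite \<A>" "\<And>A. A \<in> \<A> \<Longrightarrow> finite A \<and> card A = k"
  shows "card {xs. distinct xs \<and> set xs \<in> \<A>} = fact k * card \<A>"
proof -
  have "{xs. distinct xs \<and> set xs \<in> \<A>} = (\<Union>A\<in>\<A>. permutations_of_set A)"
    by (auto simp: permutations_of_set_def)
  also have "card \<dots> = (\<Sum>A\<in>\<A>. card (permutations_of_set A))"
    using assms(1) by (intro card_UN_disjoint) (auto dest: permutations_of_setD)
  also have "\<dots> = (\<Sum>A\<in>\<A>. fact k)"
    using assms(2) by (intro sum.cong) auto
  finally show ?thesis
    by simp
qed

text \<open>The Kovari-Sos-Turan double count: two different points of \<open>W\<close> have at most
  one common neighbour in \<open>V\<close>, so the sets \<open>T a\<close> of ordered pairs of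
  neighbours are disjoint inside \<open>W \<times> W\<close>.\<close>

lemma card_K22_free_le:
  fixes R :: "('a \<times> 'b) set"
  assumes fin: "finite V" "finite W" and card: "card V = q\<^sup>2" "card W = q\<^sup>2"
    and q: "q \<ge> 1" and sub: "R \<subseteq> V \<times> W"
    and K22: "\<And>a a' b b'. \<lbrakk>(a, b) \<in> R; (a, b') \<in> R; (a', b) \<in> R; (a', b') \<in> R; b \<noteq> b'\<rbrakk>
      \<Longrightarrow> a = a'"
  shows "card R \<le> q ^ 3 + q\<^sup>2"
proof -
  define N where "N a = {b. (a, b) \<in> R}" for a
  define D where "D = (\<Sum>a\<in>V. card (N a))"
  have finN: "finite (N a)" for a
    by (rule finite_subset[OF _ fin(2)]) (use sub in \<open>auto simp: N_def\<close>)
  have "R = (SIGMA a:V. N a)"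
    using sub by (auto simp: N_def)
  hence D: "card R = D"
    using fin(1) finN by (simp add: D_def)
  define T where "T a = {(b, b'). b \<in> N a \<and> b' \<in> N a \<and> b \<noteq> b'}" for a
  have T_sub: "T a \<subseteq> W \<times> W" for a
    using sub by (auto simp: T_def N_def)
  hence finT: "finite (T a)" for a
    using fin(2) by (meson finite_SigmaI finite_subset)
  have "(\<Sum>a\<in>V. card (T a)) = card (\<Union>a\<in>V. T a)"
    by (rule card_UN_disjoint[symmetric])
      (use fin finT K22 in \<open>auto simp: T_def N_def\<close>)
  also have "\<dots> \<le> card (W \<times> W)"
    using T_sub fin(2) by (intro card_mono) auto
  finally have sum_T: "(\<Sum>a\<in>V. card (T a)) \<le> q ^ 4"
    using card(2) by (simp add: card_cartesian_product power4_eq_xxxx power2_eq_square)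
  have square: "(card (N a))\<^sup>2 \<le> card (T a) + card (N a)" for a
  proof -
    have "(card (N a))\<^sup>2 = card (N a \<times> N a)"
      by (simp add: card_cartesian_product power2_eq_square)
    also have "N a \<times> N a = T a \<union> (\<lambda>b. (b, b)) ` N a"
      by (auto simp: T_def)
    also have "card \<dots> \<le> card (T a) + card ((\<lambda>b. (b, b)) ` N a)"
      by (rule card_Un_le)
    also have "\<dots> \<le> card (T a) + card (N a)"
      using card_image_le[OF finN, of "\<lambda>b. (b, b)" a] by simp
    finally show ?thesis .
  qed
  \<comment> \<open>The tangent to the square at \<open>q\<close>, roughly the extremal degree,
    replaces the Cauchy-Schwarz inequality and avoids square roots.\<close>
  have "2 * q * card (N a) \<le> card (T a) + card (N a) + q\<^sup>2" for a
  proof -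
    have "2 * real q * real (card (N a)) \<le> (real q)\<^sup>2 + (real (card (N a)))\<^sup>2"
      by (rule sum_squares_bound)
    hence "real (2 * q * card (N a)) \<le> real (q\<^sup>2 + (card (N a))\<^sup>2)"
      by simp
    hence "2 * q * card (N a) \<le> q\<^sup>2 + (card (N a))\<^sup>2"
      by (simp only: of_nat_le_iff)
    thus ?thesis
      using square[of a] by simp
  qed
  hence "(\<Sum>a\<in>V. 2 * q * card (N a)) \<le> (\<Sum>a\<in>V. card (T a) + card (N a) + q\<^sup>2)"
    by (intro sum_mono) auto
  hence "2 * q * D \<le> q ^ 4 + D + q ^ 4"
    using sum_T card(1)
    by (simp add: D_def sum.distrib sum_distrib_left power4_eq_xxxx power2_eq_square)
  hence "(2 * int q - 1) * int D \<le> 2 * int q ^ 4"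
  proof -
    assume "2 * q * D \<le> q ^ 4 + D + q ^ 4"
    hence "int (2 * q * D) \<le> int (q ^ 4 + D + q ^ 4)"
      by (simp only: of_nat_le_iff)
    thus ?thesis
      by (simp add: algebra_simps)
  qed
  \<comment> \<open>The two sides differ by \<open>q ^ 3 - q ^ 2\<close>, which is nonnegative
    because \<open>q\<close> is at least 1.\<close>
  also have "\<dots> \<le> (2 * int q - 1) * (int q ^ 3 + (int q)\<^sup>2)"
  proof -
    have "(int q)\<^sup>2 * int q \<ge> (int q)\<^sup>2 * 1"
      using q by (intro mult_left_mono) auto
    thus ?thesis
      by (simp add: algebra_simps power4_eq_xxxx power3_eq_cube power2_eq_square)
  qed
  finally have "int D \<le> int q ^ 3 + (int q)\<^sup>2"
    using q by simp
  thus ?thesis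
    by (simp add: D flip: of_nat_power of_nat_add)
qed

section \<open>Edges of a suspension-free complex, size by size\<close>

locale C4_suspension_free_complex =
  fixes k q :: nat and K :: "'a hypergraph"
  assumes k: "k \<ge> 2" and q: "q \<ge> 1" and complex: "abstract_complex K"
    and card_verts: "card (verts K) = q\<^sup>2"
    and avoids: "avoids_C4_suspension k (edges K)"
begin

lemma finite_verts: "finite (verts K)"
  using complex by (simp add: abstract_complex_def)

lemma edge_subset: "e \<in> edges K \<Longrightarrow> e \<subseteq> verts K"
  using complex by (auto simp: abstract_complex_def)

lemma down_closed: "\<lbrakk>e \<in> edges K; d \<subseteq> e\<rbrakk> \<Longrightarrow> d \<in> edges K"
  using complex by (auto simp: abstract_complex_def)

lemma finite_edges: "finite (edges K)"
  using finite_verts edge_subset by (meson PowI finite_Pow_iff finite_subset subsetI)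

lemma finite_edge: "e \<in> edges K \<Longrightarrow> finite e"
  using finite_verts edge_subset finite_subset by blast

definition lists_on :: "nat \<Rightarrow> 'a list set" where
  "lists_on j = {xs. distinct xs \<and> set xs \<in> {e \<in> edges K. card e = j}}"

lemma card_lists_on: "card (lists_on j) = fact j * card {e \<in> edges K. card e = j}"
  unfolding lists_on_def
  by (rule card_distinct_lists_family) (use finite_edges finite_edge in auto)

lemma length_lists_on: "xs \<in> lists_on j \<Longrightarrow> length xs = j"
  by (auto simp: lists_on_def distinct_card)

lemma finite_lists_on: "finite (lists_on j)"
proof (rule finite_subset)
  show "lists_on j \<subseteq> {xs. set xs \<subseteq> verts K \<and> length xs = j}"
    using length_lists_on edge_subset by (auto simp: lists_on_def)
qed (use finite_verts finite_lists_length_eq in blast)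

text \<open>Split an ordered \<open>k\<close>-edge into two leading vertices and a tail
  \<open>S\<close>. There are \<open>q ^ (2 * (k - 2))\<close> possible tails, and the ordered link
  relation \<open>R S\<close> satisfies the hypothesis of \<open>card_K22_free_le\<close>.\<close>

lemma card_k_edges_le:
  "fact k * card {e \<in> edges K. card e = k} \<le> q ^ (2 * k - 1) + q ^ (2 * k - 2)"
proof -
  define L where "L = {S. set S \<subseteq> verts K \<and> length S = k - 2}"
  have finL: "finite L" and cardL: "card L = (q\<^sup>2) ^ (k - 2)"
    using finite_verts finite_lists_length_eq card_lists_length_eq[of "verts K" "k - 2"]
    by (auto simp: L_def card_verts)
  define R where "R S = {(a, b). distinct (a # b # S) \<and> set (a # b # S) \<in> edges K}" for S
  have R_sub: "R S \<subseteq> verts K \<times> verts K" for S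
    using edge_subset by (fastforce simp: R_def)
  have finR: "finite (R S)" for S
    using R_sub finite_verts by (meson finite_SigmaI finite_subset)
  have "lists_on k \<subseteq> (\<lambda>(S, a, b). a # b # S) ` (SIGMA S:L. R S)"
  proof
    fix xs assume xs: "xs \<in> lists_on k"
    hence "length xs = Suc (Suc (k - 2))"
      using k length_lists_on by fastforce
    then obtain a b S where xs_eq: "xs = a # b # S" "length S = k - 2"
      by (auto simp: length_Suc_conv)
    have "S \<in> L"
      using xs edge_subset[of "set xs"] xs_eq by (auto simp: L_def lists_on_def)
    moreover have "(a, b) \<in> R S"
      using xs xs_eq by (auto simp: R_def lists_on_def)
    ultimately show "xs \<in> (\<lambda>(S, a, b). a # b # S) ` (SIGMA S:L. R S)"
      using xs_eq by force
  qed
  hence "card (lists_on k) \<le> card (SIGMA S:L. R S)"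
    using finL finR by (intro surj_card_le) auto
  also have "\<dots> = (\<Sum>S\<in>L. card (R S))"
    using finL finR by simp
  also have "\<dots> \<le> (\<Sum>S\<in>L. q ^ 3 + q\<^sup>2)"
  proof (rule sum_mono)
    fix S assume S: "S \<in> L"
    show "card (R S) \<le> q ^ 3 + q\<^sup>2"
    proof (rule card_K22_free_le[OF finite_verts finite_verts card_verts card_verts q R_sub])
      fix a a' b b' assume R: "(a, b) \<in> R S" "(a, b') \<in> R S" "(a', b) \<in> R S" "(a', b') \<in> R S"
        and "b \<noteq> b'"
      show "a = a'"
      proof (rule ccontr)
        assume "a \<noteq> a'"
        show False
          \<comment> \<open>The four pairs form the cycle \<open>a\<close>, \<open>b\<close>,
            \<open>a'\<close>, \<open>b'\<close> in the link of \<open>S\<close>; membership in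
            \<open>R S\<close> supplies the remaining distinctness.\<close>
          by (rule avoids_C4_suspensionD[OF avoids, of S a b a' b'])
            (use R S \<open>a \<noteq> a'\<close> \<open>b \<noteq> b'\<close> in \<open>auto simp: R_def L_def insert_commute\<close>)
      qed
    qed
  qed
  also have "\<dots> = q ^ (2 * (k - 2)) * (q ^ 3 + q\<^sup>2)"
    by (simp add: cardL flip: power_mult)
  also have "\<dots> = q ^ (2 * (k - 2) + 3) + q ^ (2 * (k - 2) + 2)"
    by (simp only: power_add distrib_left)
  also have "2 * (k - 2) + 3 = 2 * k - 1"
    using k by simp
  also have "2 * (k - 2) + 2 = 2 * k - 2"
    using k by simp
  finally show ?thesis
    by (simp add: card_lists_on)
qed

text \<open>Dropping the first vertex of an ordered \<open>(k + 1)\<close>-edge is injective: if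
  \<open>a\<close> and \<open>b\<close> both extend the same list \<open>x # y # S\<close>, then
  \<open>x\<close>, \<open>a\<close>, \<open>y\<close>, \<open>b\<close> is a four-cycle in the link
  of \<open>S\<close>.\<close>

lemma card_Suc_k_edges_le:
  "fact (k + 1) * card {e \<in> edges K. card e = k + 1} \<le> fact k * card {e \<in> edges K. card e = k}"
proof -
  have sub: "tl ` lists_on (k + 1) \<subseteq> lists_on k"
  proof
    fix ys assume "ys \<in> tl ` lists_on (k + 1)"
    then obtain xs where xs: "xs \<in> lists_on (k + 1)" "ys = tl xs"
      by blast
    then obtain a where a: "xs = a # ys"
      using length_lists_on[OF xs(1)] by (cases xs) auto
    have "set ys \<in> edges K"
      using xs(1) down_closed[of "set xs" "set ys"] by (auto simp: a lists_on_def)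
    moreover have "distinct ys" "length ys = k"
      using xs(1) length_lists_on[OF xs(1)] by (auto simp: a lists_on_def)
    ultimately show "ys \<in> lists_on k"
      by (simp add: lists_on_def distinct_card)
  qed
  have "inj_on tl (lists_on (k + 1))"
  proof
    fix xs xs' assume xs: "xs \<in> lists_on (k + 1)" "xs' \<in> lists_on (k + 1)" "tl xs = tl xs'"
    \<comment> \<open>This is \<open>k + 1\<close>, written so that three entries split off and
      leave a spine of length \<open>k - 2\<close>.\<close>
    have "length xs = Suc (Suc (Suc (k - 2)))" "length xs' = Suc (length (tl xs))"
      using xs length_lists_on k by fastforce+
    then obtain a b x y S where S: "xs = a # x # y # S" "xs' = b # x # y # S"
      "length S = k - 2"
      using xs(3) by (auto simp: length_Suc_conv)
    have edge: "set xs \<in> edges K" "set xs' \<in> edges K" "distinct xs" "distinct xs'"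
      using xs by (auto simp: lists_on_def)
    show "xs = xs'"
    proof (rule ccontr)
      assume "xs \<noteq> xs'"
      show False
        by (rule avoids_C4_suspensionD[OF avoids, of S x a y b])
          (use S edge \<open>xs \<noteq> xs'\<close> in \<open>auto intro: down_closed\<close>)
    qed
  qed
  hence "card (lists_on (k + 1)) \<le> card (lists_on k)"
    using sub finite_lists_on by (intro card_inj_on_le) auto
  thus ?thesis
    by (simp only: card_lists_on)
qed

text \<open>An edge with \<open>k + 2\<close> vertices already contains all vertices of a suspended
  four-cycle, and by downward closure all its edges.\<close>

lemma card_edge_le:
  assumes "e \<in> edges K"
  shows "card e \<le> k + 1"
proof (rule ccontr)
  assume "\<not> card e \<le> k + 1"
  obtain xs where xs: "set xs = e" "distinct xs"
    using finite_distinct_list[OF finite_edge[OF assms]] by blast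
  have "length xs \<ge> Suc (Suc (Suc (Suc (k - 2))))"
    using \<open>\<not> card e \<le> k + 1\<close> k distinct_card[OF xs(2)] xs(1) by simp
  then obtain a b c d ys where ys: "xs = a # b # c # d # ys" "length ys \<ge> k - 2"
    by (auto simp: Suc_le_length_iff)
  define S where "S = take (k - 2) ys"
  have S: "set S \<subseteq> set ys" "distinct S" "length S = k - 2"
    using xs ys by (auto simp: S_def set_take_subset)
  show False
    by (rule avoids_C4_suspensionD[OF avoids, of S a b c d])
      (use S xs ys assms in \<open>auto intro: down_closed\<close>)
qed

text \<open>Each of the \<open>k\<close> sizes below \<open>k\<close> contributes at most
  \<open>n ^ (k - 1)\<close> sets with \<open>n = q ^ 2\<close>, so these edges belong to the error
  term.\<close>

lemma card_small_edges_le: "card {e \<in> edges K. card e < k} \<le> k * q ^ (2 * k - 2)"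
proof -
  have "{e \<in> edges K. card e < k} \<subseteq> (\<Union>j<k. {e. e \<subseteq> verts K \<and> card e = j})"
    using edge_subset by auto
  hence "card {e \<in> edges K. card e < k} \<le> card (\<Union>j<k. {e. e \<subseteq> verts K \<and> card e = j})"
    using finite_verts by (intro card_mono) auto
  also have "\<dots> \<le> (\<Sum>j<k. card {e. e \<subseteq> verts K \<and> card e = j})"
    by (rule card_UN_le) simp
  also have "\<dots> \<le> (\<Sum>j<k. q ^ (2 * k - 2))"
  proof (rule sum_mono)
    fix j assume "j \<in> {..<k}"
    have "card {e. e \<subseteq> verts K \<and> card e = j} = q\<^sup>2 choose j"
      using n_subsets[OF finite_verts] by (simp add: card_verts)
    also have "\<dots> \<le> (q\<^sup>2) ^ j"
      using binomial_le_pow[of j "q\<^sup>2"] by (cases "j \<le> q\<^sup>2") (auto simp: binomial_eq_0)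
    also have "\<dots> = q ^ (2 * j)"
      by (simp add: power_mult)
    also have "\<dots> \<le> q ^ (2 * k - 2)"
      using q \<open>j \<in> {..<k}\<close> by (intro power_increasing) auto
    finally show "card {e. e \<subseteq> verts K \<and> card e = j} \<le> q ^ (2 * k - 2)" .
  qed
  finally show ?thesis
    by simp
qed

text \<open>In the error constant, \<open>k\<close> accounts for the small edges. The 2 bounds
  \<open>1 / fact k + 1 / fact (k + 1)\<close>, the factor of the lower-order term in
  \<open>card_k_edges_le\<close>.\<close>

lemma card_edges_le:
  "real (card (edges K)) \<le> (1 / fact k + 1 / fact (k + 1)) * real q ^ (2 * k - 1)
     + (k + 2) * real q ^ (2 * k - 2)"
proof -
  define A B C where "A = {e \<in> edges K. card e = k}" and "B = {e \<in> edges K. card e = k + 1}"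
    and "C = {e \<in> edges K. card e < k}"
  have "edges K = (A \<union> B) \<union> C"
    using card_edge_le unfolding A_def B_def C_def by fastforce
  hence "card (edges K) \<le> card A + card B + card C"
    by (metis add_le_mono1 card_Un_le order_trans)
  hence le: "real (card (edges K)) \<le> real (card A) + real (card B) + real (card C)"
    by linarith
  define M :: real where "M = real q ^ (2 * k - 1) + real q ^ (2 * k - 2)"
  have kA: "fact k * real (card A) \<le> M"
    using card_k_edges_le unfolding A_def M_def
    by (metis (mono_tags, lifting) of_nat_add of_nat_fact of_nat_le_iff of_nat_mult of_nat_power)
  have "fact (k + 1) * real (card B) \<le> fact k * real (card A)"
    using card_Suc_k_edges_le unfolding A_def B_def
    by (metis (mono_tags, lifting) of_nat_fact of_nat_le_iff of_nat_mult)
  hence kB: "fact (k + 1) * real (card B) \<le> M"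
    using kA by linarith
  have "real (card A) \<le> 1 / fact k * M"
    using kA by (simp add: field_simps)
  moreover have "real (card B) \<le> 1 / fact (k + 1) * M"
    using kB by (simp add: field_simps del: fact_Suc)
  moreover have "real (card C) \<le> k * real q ^ (2 * k - 2)"
    using card_small_edges_le unfolding C_def
    by (metis (mono_tags, lifting) of_nat_le_iff of_nat_mult of_nat_power)
  moreover have "(1 / fact k + 1 / fact (k + 1)) * real q ^ (2 * k - 2) \<le> 2 * real q ^ (2 * k - 2)"
  proof (rule mult_right_mono)
    have "1 / fact j \<le> (1 :: real)" for j
      by simp
    from this[of k] this[of "k + 1"] show "1 / fact k + 1 / fact (k + 1) \<le> (2 :: real)"
      by linarith
  qed simp
  ultimately show ?thesis
    using le by (simp add: M_def algebra_simps del: fact_Suc)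
qed

end

section \<open>Finite fields of characteristic two\<close>

text \<open>Over an algebraically closed field the multiset of roots has size
  \<open>degree p\<close>; a repeated root would also be a root of the derivative, so the multiset
  is a set.\<close>

lemma card_simple_roots:
  fixes p :: "'a :: alg_closed_field poly"
  assumes "p \<noteq> 0" and simple: "\<And>x. poly p x = 0 \<Longrightarrow> poly (pderiv p) x \<noteq> 0"
  shows "card {x. poly p x = 0} = degree p"
proof -
  have order_le: "order x p \<le> 1" for x
  proof (rule ccontr)
    assume "\<not> order x p \<le> 1"
    hence "[:-x, 1:] ^ 2 dvd p"
      by (intro order_divides[THEN iffD2]) auto
    then obtain r where "p = [:-x, 1:] ^ 2 * r"
      by (elim dvdE)
    hence "p = [:-x, 1:] * ([:-x, 1:] * r)"
      by (simp only: power2_eq_square mult.assoc)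
    moreover from this have "poly (pderiv p) x = 0"
      by (simp only: pderiv_mult poly_add poly_mult) simp
    ultimately show False
      using simple by simp
  qed
  obtain A where A: "size A = degree p" "p = smult (lead_coeff p) (\<Prod>x\<in>#A. [:-x, 1:])"
    using alg_closed_imp_factorization assms(1) by blast
  have "proots p = proots (\<Prod>x\<in>#A. [:-x, 1:])"
    using A(2) \<open>p \<noteq> 0\<close> by (metis leading_coeff_0_iff proots_smult)
  also have "\<dots> = A"
  proof (induction A)
    case (add x A)
    have "(\<Prod>x\<in>#A. [:-x, 1:]) \<noteq> 0"
      by (auto simp: prod_mset_zero_iff)
    thus ?case
      using add by (simp add: proots_mult del: mult_pCons_left)
  qed simp
  finally have "size (proots p) = degree p"
    using A(1) by simp
  moreover have "count (proots p) x = (if x \<in># proots p then 1 else 0)" for x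
    using order_le[of x] \<open>p \<noteq> 0\<close> by (auto simp: order_root le_Suc_eq)
  hence "size (proots p) = card (set_mset (proots p))"
    by (simp add: size_multiset_overloaded_eq)
  ultimately show ?thesis
    using \<open>p \<noteq> 0\<close> by simp
qed

text \<open>The field is a subset of a fixed ambient field, not a type, because its size has to vary
  with \<open>m\<close>.\<close>

locale finite_char2_subfield =
  fixes F :: "'a :: field set"
  assumes add_self: "x + x = (0 :: 'a)"
    and finite_F: "finite F"
    and zero_in: "0 \<in> F"
    and one_in: "1 \<in> F"
    and add_in: "\<lbrakk>x \<in> F; y \<in> F\<rbrakk> \<Longrightarrow> x + y \<in> F"
    and mult_in: "\<lbrakk>x \<in> F; y \<in> F\<rbrakk> \<Longrightarrow> x * y \<in> F"
    and inverse_in: "x \<in> F \<Longrightarrow> inverse x \<in> F"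

text \<open>Additivity of the iterated Frobenius map; the cross term of each squaring carries the
  factor 2.\<close>

lemma add_power_char2:
  fixes x y :: "'a :: comm_ring_1"
  assumes "(2 :: 'a) = 0"
  shows "(x + y) ^ (2 ^ m) = x ^ (2 ^ m) + y ^ (2 ^ m)"
proof (induction m)
  case (Suc m)
  have "(x + y) ^ (2 ^ Suc m) = ((x + y) ^ (2 ^ m))\<^sup>2"
    by (simp add: power_mult [symmetric] mult.commute)
  also have "\<dots> = (x ^ (2 ^ m))\<^sup>2 + (y ^ (2 ^ m))\<^sup>2"
    by (simp add: Suc.IH power2_sum assms)
  finally show ?case
    by (simp add: power_mult [symmetric] mult.commute)
qed simp

text \<open>The field with \<open>q\<close> elements is the root set of \<open>X^q - X\<close> in
  the algebraic closure of the two-element field. Frobenius gives closure under addition.\<close>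

lemma finite_char2_subfield_exists:
  assumes "m > 0"
  shows "\<exists>F :: bit alg_closure set. finite_char2_subfield F \<and> card F = 2 ^ m"
proof -
  define q :: nat where "q = 2 ^ m"
  have q: "q > 1"
    using one_less_power[of "2 :: nat" m] assms by (simp add: q_def)
  define F where "F = {x :: bit alg_closure. x ^ q = x}"
  have two: "(2 :: bit alg_closure) = 0"
    by (metis bit_numeral_even to_ac_0 to_ac_numeral)
  define p :: "bit alg_closure poly" where "p = monom 1 q - monom 1 1"
  have poly_p: "poly p x = x ^ q - x" for x
    by (simp add: p_def poly_monom)
  have F_roots: "F = {x. poly p x = 0}"
    by (simp add: F_def poly_p)
  have deg: "degree p = q"
    unfolding p_def using q
    by (simp add: degree_monom_eq degree_add_eq_left flip: add_uminus_conv_diff)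
  have "(of_nat q :: bit alg_closure) = 0"
    using assms two by (simp add: q_def)
  \<comment> \<open>The leading term vanishes because \<open>q\<close> is even, so the derivative
    has no roots and all roots of \<open>p\<close> are simple.\<close>
  hence "pderiv p = - 1"
    by (simp add: p_def pderiv_diff pderiv_monom flip: monom_eq_1)
  moreover have "p \<noteq> 0"
    using deg q by auto
  ultimately have card: "card F = q"
    using card_simple_roots[of p] deg F_roots by simp
  have "finite_char2_subfield F"
  proof
    show "x + x = 0" for x :: "bit alg_closure"
      by (metis mult_2 mult_zero_left two)
    show "finite F"
      using card q by (simp add: card_ge_0_finite)
    show "0 \<in> F" "1 \<in> F"
      using q by (simp_all add: F_def)
    show "x + y \<in> F" if "x \<in> F" "y \<in> F" for x y
      using that by (simp add: F_def q_def add_power_char2[OF two])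
    show "x * y \<in> F" if "x \<in> F" "y \<in> F" for x y
      using that by (simp add: F_def power_mult_distrib)
    show "inverse x \<in> F" if "x \<in> F" for x
      using that by (simp add: F_def power_inverse)
  qed
  thus ?thesis
    using card q_def by blast
qed

section \<open>The extremal construction\<close>

text \<open>The determinant \<open>det\<close> of the overview. The plus sign agrees with the usual
  minus in characteristic two and makes the form symmetric in any ring.\<close>

definition wedge :: "'a :: comm_ring_1 \<times> 'a \<Rightarrow> 'a \<times> 'a \<Rightarrow> 'a" where
  "wedge u v = fst u * snd v + snd u * fst v"

lemma wedge_commute: "wedge u v = wedge v u"
  by (simp add: wedge_def algebra_simps)

lemma wedge_add_left: "wedge (u + v) w = wedge u w + wedge v w"
  by (simp add: wedge_def algebra_simps)

lemma wedge_add_right: "wedge w (u + v) = wedge w u + wedge w v"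
  by (simp add: wedge_def algebra_simps)

lemma wedge_zero_right [simp]: "wedge u 0 = 0"
  by (simp add: wedge_def)

text \<open>Either the head recurs in the tail, with at most \<open>length\<close> of the tail many
  choices, or the tail itself has a repetition. Such lists cost a factor \<open>card V\<close>
  against all lists and hence only affect the error term.\<close>

lemma card_nondistinct_lists_le:
  assumes "finite V"
  shows "card {xs. set xs \<subseteq> V \<and> length xs = Suc j \<and> \<not> distinct xs} \<le> (Suc j)\<^sup>2 * card V ^ j"
proof (induction j)
  case 0
  have "{xs. set xs \<subseteq> V \<and> length xs = Suc 0 \<and> \<not> distinct xs} = {}"
    by (auto simp: length_Suc_conv)
  thus ?case
    by (simp only: card.empty)
next
  case (Suc j)
  define L where "L = {xs. set xs \<subseteq> V \<and> length xs = Suc j}"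
  define N where "N = {xs. set xs \<subseteq> V \<and> length xs = Suc j \<and> \<not> distinct xs}"
  have finL: "finite L" and cardL: "card L = card V ^ Suc j"
    using assms finite_lists_length_eq card_lists_length_eq[of V "Suc j"] by (auto simp: L_def)
  have finN: "finite N"
    by (rule finite_subset[OF _ finL]) (auto simp: N_def L_def)
  have "{xs. set xs \<subseteq> V \<and> length xs = Suc (Suc j) \<and> \<not> distinct xs}
      \<subseteq> (\<lambda>(xs, x). x # xs) ` ((SIGMA xs:L. set xs) \<union> (SIGMA xs:N. V))"
  proof
    fix ys assume ys: "ys \<in> {xs. set xs \<subseteq> V \<and> length xs = Suc (Suc j) \<and> \<not> distinct xs}"
    then obtain x xs where x: "ys = x # xs" "length xs = Suc j"
      by (auto simp: length_Suc_conv)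
    have "(xs, x) \<in> (SIGMA xs:L. set xs) \<union> (SIGMA xs:N. V)"
      using ys x by (auto simp: L_def N_def)
    thus "ys \<in> (\<lambda>(xs, x). x # xs) ` ((SIGMA xs:L. set xs) \<union> (SIGMA xs:N. V))"
      using x(1) by (force simp: image_iff)
  qed
  hence "card {xs. set xs \<subseteq> V \<and> length xs = Suc (Suc j) \<and> \<not> distinct xs}
      \<le> card ((SIGMA xs:L. set xs) \<union> (SIGMA xs:N. V))"
    using finL finN assms by (intro surj_card_le) auto
  also have "\<dots> \<le> card (SIGMA xs:L. set xs) + card (SIGMA xs:N. V)"
    by (rule card_Un_le)
  also have "card (SIGMA xs:L. set xs) = (\<Sum>xs\<in>L. card (set xs))"
    using finL by simp
  also have "(\<Sum>xs\<in>L. card (set xs)) \<le> (\<Sum>xs\<in>L. Suc j)"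
    by (intro sum_mono) (metis (mono_tags, lifting) L_def card_length mem_Collect_eq)
  also have "(\<Sum>xs\<in>L. Suc j) = Suc j * card V ^ Suc j"
    by (simp add: cardL)
  also have "card (SIGMA xs:N. V) = card N * card V"
    using finN assms by simp
  also have "\<dots> \<le> (Suc j)\<^sup>2 * card V ^ j * card V"
    using Suc.IH unfolding N_def by (rule mult_right_mono) simp
  also have "Suc j * card V ^ Suc j + (Suc j)\<^sup>2 * card V ^ j * card V
      = (Suc j + (Suc j)\<^sup>2) * card V ^ Suc j"
    by (simp add: algebra_simps)
  also have "\<dots> \<le> (Suc (Suc j))\<^sup>2 * card V ^ Suc j"
    by (intro mult_right_mono) (auto simp: power2_eq_square)
  finally show ?case
    by simp
qed

section \<open>The determinant form on the finite plane\<close>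

context finite_char2_subfield
begin

lemma add_eq_0_iff_eq: "x + y = 0 \<longleftrightarrow> x = (y :: 'a)"
  by (metis add_self add_left_cancel)

lemma vec_add_self: "v + v = (0 :: 'a \<times> 'a)"
  by (simp add: prod_eq_iff add_self)

lemma vec_add_eq_0_iff: "u + v = 0 \<longleftrightarrow> u = (v :: 'a \<times> 'a)"
  by (simp add: prod_eq_iff add_eq_0_iff_eq)

lemma wedge_self: "wedge v v = (0 :: 'a)"
  by (simp add: wedge_def mult.commute add_self)

text \<open>Two vectors parallel to the same nonzero \<open>w\<close> are parallel to each other.
  Both coordinates of \<open>w\<close> annihilate \<open>wedge p r\<close>, and one of them is
  invertible.\<close>

lemma wedge_eq_0_trans:
  fixes w p r :: "'a \<times> 'a"
  assumes "w \<noteq> 0" "wedge w p = 0" "wedge w r = 0"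
  shows "wedge p r = 0"
proof -
  have p: "fst w * snd p = snd w * fst p" and r: "fst w * snd r = snd w * fst r"
    using assms(2,3) by (auto simp: wedge_def add_eq_0_iff_eq)
  have "fst w * wedge p r = fst p * (fst w * snd r) + (fst w * snd p) * fst r"
    by (simp add: wedge_def algebra_simps)
  also have "\<dots> = fst p * (snd w * fst r) + snd w * fst p * fst r"
    by (simp only: p r)
  also have "\<dots> = fst p * (snd w * fst r) + fst p * (snd w * fst r)"
    by (simp add: mult_ac)
  finally have fst: "fst w * wedge p r = 0"
    by (simp add: add_self)
  have "snd w * wedge p r = (snd w * fst p) * snd r + snd p * (snd w * fst r)"
    by (simp add: wedge_def algebra_simps)
  also have "\<dots> = (fst w * snd p) * snd r + snd p * (fst w * snd r)"
    by (simp only: p r)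
  also have "\<dots> = fst w * snd p * snd r + fst w * snd p * snd r"
    by (simp add: mult_ac)
  finally have snd: "snd w * wedge p r = 0"
    by (simp add: add_self)
  show ?thesis
    using fst snd assms(1) by (auto simp: prod_eq_iff)
qed

abbreviation q :: nat where "q \<equiv> card F"

definition V :: "('a \<times> 'a) set" where "V = F \<times> F"

lemma finite_V: "finite V"
  by (simp add: V_def finite_F)

lemma card_V: "card V = q\<^sup>2"
  by (simp add: V_def card_cartesian_product power2_eq_square)

lemma zero_in_V: "0 \<in> V"
  by (simp add: V_def zero_prod_def zero_in)

lemma add_in_V: "u \<in> V \<Longrightarrow> v \<in> V \<Longrightarrow> u + v \<in> V"
  by (auto simp: V_def plus_prod_def add_in)

lemma sum_in_V: "e \<subseteq> V \<Longrightarrow> \<Sum>e \<in> V"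
  by (induction e rule: infinite_finite_induct) (auto simp: zero_in_V add_in_V)

lemma sum_list_in_V: "set xs \<subseteq> V \<Longrightarrow> sum_list xs \<in> V"
  by (induction xs) (auto simp: zero_in_V add_in_V)

lemma wedge_in: "u \<in> V \<Longrightarrow> v \<in> V \<Longrightarrow> wedge u v \<in> F"
  by (auto simp: V_def wedge_def add_in mult_in)

lemma q_ge_2: "q \<ge> 2"
proof -
  have "card {0, 1 :: 'a} \<le> q"
    by (rule card_mono) (auto simp: finite_F zero_in one_in)
  thus ?thesis
    by simp
qed

text \<open>The equation defines an affine line. It can be solved for the second coordinate of
  \<open>b\<close> if \<open>fst w\<close> is nonzero, and otherwise fixes the first
  coordinate.\<close>

lemma card_line:
  assumes w: "w \<in> V" "w \<noteq> 0" and c: "c \<in> F"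
  shows "card {b \<in> V. wedge w b = c} = q"
proof (cases "fst w = 0")
  case False
  have "{b \<in> V. wedge w b = c} = (\<lambda>x. (x, inverse (fst w) * (c + snd w * x))) ` F" (is "?A = ?B")
  proof
    show "?A \<subseteq> ?B"
    proof
      fix b assume b: "b \<in> ?A"
      have "c + snd w * fst b = fst w * snd b + (snd w * fst b + snd w * fst b)"
        using b by (auto simp: wedge_def add_ac mult_ac)
      hence "inverse (fst w) * (c + snd w * fst b) = snd b"
        using False by (simp add: add_self)
      thus "b \<in> ?B"
        using b by (force simp: V_def image_iff prod_eq_iff)
    qed
    show "?B \<subseteq> ?A"
    proof
      fix b assume "b \<in> ?B"
      then obtain x where x: "x \<in> F" "b = (x, inverse (fst w) * (c + snd w * x))"
        by blast
      have "wedge w b = c + (snd w * x + snd w * x)"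
        using False by (simp add: wedge_def x(2) field_simps)
      thus "b \<in> ?A"
        using x w c by (auto simp: V_def add_self intro!: mult_in inverse_in add_in)
    qed
  qed
  moreover have "inj_on (\<lambda>x. (x, inverse (fst w) * (c + snd w * x))) F"
    by (auto simp: inj_on_def)
  ultimately show ?thesis
    by (simp add: card_image)
next
  case True
  hence "snd w \<noteq> 0"
    using w(2) by (simp add: prod_eq_iff)
  hence "wedge w b = c \<longleftrightarrow> fst b = inverse (snd w) * c" for b
    by (auto simp: wedge_def True field_simps)
  moreover have "inverse (snd w) * c \<in> F"
    using w c by (auto simp: V_def intro!: mult_in inverse_in)
  ultimately have "{b \<in> V. wedge w b = c} = Pair (inverse (snd w) * c) ` F"
    by (auto simp: V_def)
  moreover have "inj_on (Pair (inverse (snd w) * c)) F"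
    by (auto simp: inj_on_def)
  ultimately show ?thesis
    by (simp add: card_image)
qed

text \<open>In characteristic two, \<open>Q e\<close> equals the sum of \<open>wedge u v\<close> over the two-element
  subsets of \<open>e\<close>; the form below is visibly independent of an ordering.\<close>

definition Q :: "('a \<times> 'a) set \<Rightarrow> 'a" where
  "Q e = fst (\<Sum>e) * snd (\<Sum>e) + (\<Sum>v\<in>e. fst v * snd v)"

text \<open>The diagonal term \<open>fst v * snd v\<close> arises twice, from the product of the
  coordinate sums and from the sum of products, and cancels.\<close>

lemma Q_insert:
  assumes "finite e" "v \<notin> e"
  shows "Q (insert v e) = Q e + wedge v (\<Sum>e)"
proof -
  have "Q (insert v e) = Q e + wedge v (\<Sum>e) + (fst v * snd v + fst v * snd v)"
    using assms by (simp add: Q_def wedge_def algebra_simps)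
  thus ?thesis
    by (simp add: add_self)
qed

text \<open>Translating both vectors by the sum of \<open>e\<close> absorbs the linear terms, since
  the form vanishes on the diagonal. This exhibits the link of \<open>e\<close> as a translate of a
  level graph of \<open>wedge\<close>.\<close>

lemma Q_insert2:
  assumes "finite e" "u \<notin> e" "v \<notin> e" "u \<noteq> v"
  shows "Q (insert u (insert v e)) = Q e + wedge (u + \<Sum>e) (v + \<Sum>e)"
  using assms
  by (simp add: Q_insert wedge_add_left wedge_add_right wedge_self wedge_commute[of v] add_ac)

text \<open>A version of \<open>Q\<close> that tolerates repetitions, so that entries can range
  freely over \<open>V\<close> in the counts and repetitions be removed afterwards.\<close>

primrec Q_list :: "('a \<times> 'a) list \<Rightarrow> 'a" where
  "Q_list [] = 0"
| "Q_list (v # xs) = Q_list xs + wedge v (sum_list xs)"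

lemma sum_list_distinct: "distinct xs \<Longrightarrow> sum_list xs = \<Sum>(set xs)" for xs :: "('a \<times> 'a) list"
  by (simp add: sum_list_distinct_conv_sum_set[of _ id, simplified])

lemma Q_list_distinct: "distinct xs \<Longrightarrow> Q_list xs = Q (set xs)"
  by (induction xs) (auto simp: Q_insert sum_list_distinct, simp add: Q_def)

lemma Q_list_in: "set xs \<subseteq> V \<Longrightarrow> Q_list xs \<in> F"
  by (induction xs) (auto simp: zero_in add_in wedge_in sum_list_in_V)

section \<open>Counting lists of value one\<close>

definition vlists :: "nat \<Rightarrow> ('a \<times> 'a) list set" where
  "vlists j = {xs. set xs \<subseteq> V \<and> length xs = j}"

definition unit_lists :: "nat \<Rightarrow> ('a \<times> 'a) list set" where
  "unit_lists j = {xs \<in> vlists j. Q_list xs = 1}"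

definition extensions :: "('a \<times> 'a) list \<Rightarrow> (('a \<times> 'a) \<times> ('a \<times> 'a)) set" where
  "extensions xs = {(a, b). a \<in> V \<and> b \<in> V \<and> Q_list (a # b # xs) = 1}"

lemma finite_vlists: "finite (vlists j)" and card_vlists: "card (vlists j) = q ^ (2 * j)"
  using finite_V finite_lists_length_eq card_lists_length_eq[of V j]
  by (auto simp: vlists_def card_V power_mult)

lemma finite_unit_lists: "finite (unit_lists j)"
  using finite_vlists by (simp add: unit_lists_def)

lemma finite_extensions: "finite (extensions xs)"
  by (rule finite_subset[of _ "V \<times> V"]) (auto simp: extensions_def finite_V)

text \<open>For each \<open>a\<close> other than the sum \<open>s\<close> of \<open>xs\<close>, the
  admissible \<open>b\<close> form a line with \<open>q\<close> points. Only \<open>a = s\<close> is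
  exceptional, contributing between 0 and \<open>q ^ 2\<close> pairs to the main count
  \<open>(q ^ 2 - 1) * q\<close>.\<close>

lemma card_extensions:
  assumes "set xs \<subseteq> V"
  shows "q ^ 3 \<le> card (extensions xs) + q" "card (extensions xs) \<le> 2 * q ^ 3"
proof -
  define s where "s = sum_list xs"
  define N where "N a = {b \<in> V. Q_list (a # b # xs) = 1}" for a
  have s: "s \<in> V"
    using assms by (simp add: s_def sum_list_in_V)
  have N_le: "card (N a) \<le> q\<^sup>2" for a
    unfolding card_V[symmetric] N_def by (rule card_mono) (auto simp: finite_V)
  have N_eq: "card (N a) = q" if "a \<in> V" "a \<noteq> s" for a
  proof -
    have "Q_list (a # b # xs) = wedge (a + s) b + (Q_list xs + wedge a s)" for b
      by (simp add: s_def wedge_add_left wedge_add_right wedge_commute[of b] add_ac)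
    moreover have "x + y = 1 \<longleftrightarrow> x = 1 + y" for x y :: 'a
      by (metis add.assoc add.right_neutral add_self)
    ultimately have "N a = {b \<in> V. wedge (a + s) b = 1 + (Q_list xs + wedge a s)}"
      by (simp only: N_def)
    moreover have "a + s \<noteq> 0"
      using that by (simp add: vec_add_eq_0_iff)
    ultimately show ?thesis
      using that s assms by (simp add: card_line add_in_V add_in one_in wedge_in Q_list_in)
  qed
  have "extensions xs = (SIGMA a:V. N a)"
    by (auto simp: extensions_def N_def)
  hence "card (extensions xs) = (\<Sum>a\<in>V. card (N a))"
    using finite_V by (simp add: N_def)
  also have "\<dots> = card (N s) + (\<Sum>a\<in>V - {s}. card (N a))"
    using s finite_V by (rule sum.remove[rotated])
  also have "(\<Sum>a\<in>V - {s}. card (N a)) = (q\<^sup>2 - 1) * q"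
    using N_eq s finite_V by (simp add: card_V)
  finally have card: "card (extensions xs) = card (N s) + (q\<^sup>2 - 1) * q" .
  have eq: "(q\<^sup>2 - 1) * q + q = q ^ 3"
    using q_ge_2 by (simp add: power2_eq_square power3_eq_cube algebra_simps)
  show "q ^ 3 \<le> card (extensions xs) + q"
    using card eq by linarith
  have "q\<^sup>2 \<le> q ^ 3"
    using q_ge_2 by (intro power_increasing) auto
  thus "card (extensions xs) \<le> 2 * q ^ 3"
    using card eq N_le[of s] by linarith
qed

lemma unit_lists_Suc_Suc:
  "unit_lists (Suc (Suc j)) = (\<lambda>(xs, a, b). a # b # xs) ` (SIGMA xs:vlists j. extensions xs)"
  by (fastforce simp: unit_lists_def vlists_def extensions_def length_Suc_conv image_iff)

lemma card_unit_lists_Suc_Suc: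
  "card (unit_lists (Suc (Suc j))) = (\<Sum>xs\<in>vlists j. card (extensions xs))"
proof -
  have "inj_on (\<lambda>(xs, a, b). a # b # xs) (SIGMA xs:vlists j. extensions xs)"
    by (auto simp: inj_on_def)
  thus ?thesis
    by (simp add: unit_lists_Suc_Suc card_image finite_vlists finite_extensions)
qed

lemma card_unit_lists_ge:
  "q ^ (2 * j + 3) \<le> card (unit_lists (Suc (Suc j))) + q ^ (2 * j + 1)"
proof -
  have "q ^ (2 * j + 3) = (\<Sum>xs\<in>vlists j. q ^ 3)"
    by (simp add: card_vlists power_add)
  also have "\<dots> \<le> (\<Sum>xs\<in>vlists j. card (extensions xs) + q)"
    by (intro sum_mono card_extensions(1)) (simp add: vlists_def)
  also have "\<dots> = card (unit_lists (Suc (Suc j))) + q ^ (2 * j + 1)"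
    by (simp add: card_unit_lists_Suc_Suc sum.distrib card_vlists)
  finally show ?thesis .
qed

text \<open>Prescribing the value saves a factor of order \<open>q\<close>; the multiplied form
  avoids a division for short lists. Lists of length below two have value 0.\<close>

lemma card_unit_lists_le: "q * card (unit_lists j) \<le> 2 * q ^ (2 * j)"
proof (cases "j < 2")
  case True
  hence "unit_lists j = {}"
    by (auto simp: unit_lists_def vlists_def less_2_cases_iff length_Suc_conv)
  thus ?thesis
    by simp
next
  case False
  then obtain i where i: "j = Suc (Suc i)"
    by (metis One_nat_def Suc_1 add_2_eq_Suc le_Suc_ex not_less)
  have "card (unit_lists j) \<le> (\<Sum>xs\<in>vlists i. 2 * q ^ 3)"
    unfolding i card_unit_lists_Suc_Suc
    by (intro sum_mono card_extensions(2)) (simp add: vlists_def)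
  also have "\<dots> = q ^ (2 * i) * (2 * q ^ 3)"
    by (simp add: card_vlists)
  finally have "q * card (unit_lists j) \<le> q * (q ^ (2 * i) * (2 * q ^ 3))"
    by simp
  also have "\<dots> = 2 * q ^ (2 * i + 4)"
    by (simp add: power_add eval_nat_numeral algebra_simps)
  also have "2 * i + 4 = 2 * j"
    by (simp add: i)
  finally show ?thesis .
qed

section \<open>Candidate edges and their degenerate members\<close>

definition unit_sets :: "nat \<Rightarrow> ('a \<times> 'a) set set" where
  "unit_sets j = {e. e \<subseteq> V \<and> card e = Suc (Suc j) \<and> Q e = 1}"

text \<open>With \<open>k = j + 2\<close>, the set \<open>S\<close> is a possible spine whose link
  would be governed by \<open>wedge\<close> having value 0, the one level at which four-cycles are
  not excluded.\<close>

definition degenerate :: "nat \<Rightarrow> ('a \<times> 'a) set \<Rightarrow> bool" where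
  "degenerate j e \<longleftrightarrow> (\<exists>S\<subseteq>e. card S = j \<and> Q S = 1)"

definition zero_sum_sets :: "nat \<Rightarrow> ('a \<times> 'a) set set" where
  "zero_sum_sets j = {e. e \<subseteq> V \<and> card e = Suc (Suc (Suc j)) \<and> \<Sum>e = 0 \<and> Q e = 1}"

lemma finite_subset_V: "e \<subseteq> V \<Longrightarrow> finite e"
  using finite_V finite_subset by blast

lemma finite_unit_sets: "finite (unit_sets j)"
  by (rule finite_subset[of _ "Pow V"]) (auto simp: unit_sets_def finite_V)

lemma finite_zero_sum_sets: "finite (zero_sum_sets j)"
  by (rule finite_subset[of _ "Pow V"]) (auto simp: zero_sum_sets_def finite_V)

lemma vlists_of_set:
  assumes "e \<subseteq> V"
  obtains xs where "xs \<in> vlists (card e)" "distinct xs" "set xs = e" "Q_list xs = Q e"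
    "sum_list xs = \<Sum>e"
proof -
  obtain xs where "set xs = e" "distinct xs"
    using finite_distinct_list[OF finite_subset_V[OF assms]] by blast
  thus thesis
    using that[of xs] assms by (auto simp: vlists_def Q_list_distinct sum_list_distinct distinct_card)
qed

text \<open>A list of value one either orders a unit set or has a repetition. The 1 in the error
  constant absorbs the loss \<open>q ^ (2 * j + 1)\<close> of
  \<open>card_unit_lists_ge\<close>.\<close>

lemma card_unit_sets_ge:
  "q ^ (2 * j + 3)
    \<le> fact (Suc (Suc j)) * card (unit_sets j) + (1 + (Suc (Suc j))\<^sup>2) * q ^ (2 * j + 2)"
proof -
  define N where "N = {xs. set xs \<subseteq> V \<and> length xs = Suc (Suc j) \<and> \<not> distinct xs}"
  define D where "D = {xs. distinct xs \<and> set xs \<in> unit_sets j}"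
  have "unit_lists (Suc (Suc j)) \<subseteq> D \<union> N"
    by (auto simp: unit_lists_def vlists_def D_def N_def unit_sets_def Q_list_distinct distinct_card)
  moreover have "D \<subseteq> vlists (Suc (Suc j))"
    by (auto simp: D_def unit_sets_def vlists_def distinct_card)
  hence "finite D"
    using finite_vlists finite_subset by blast
  moreover have "N \<subseteq> vlists (Suc (Suc j))"
    by (auto simp: N_def vlists_def)
  hence "finite N"
    using finite_vlists finite_subset by blast
  ultimately have "card (unit_lists (Suc (Suc j))) \<le> card D + card N"
    by (meson card_Un_le card_mono finite_UnI order_trans)
  moreover have "card D = fact (Suc (Suc j)) * card (unit_sets j)"
    unfolding D_def by (rule card_distinct_lists_family[OF finite_unit_sets])
      (auto simp: unit_sets_def finite_subset_V)
  moreover have "card N \<le> (Suc (Suc j))\<^sup>2 * q ^ (2 * j + 2)"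
  proof -
    have "card V ^ Suc j = q ^ (2 * Suc j)"
      by (simp only: card_V power_mult)
    also have "2 * Suc j = 2 * j + 2"
      by simp
    finally have "card V ^ Suc j = q ^ (2 * j + 2)" .
    thus ?thesis
      using card_nondistinct_lists_le[OF finite_V, of "Suc j"] by (simp only: N_def)
  qed
  moreover have "q ^ (2 * j + 1) \<le> q ^ (2 * j + 2)"
    using q_ge_2 by (intro power_increasing) auto
  ultimately show ?thesis
    using card_unit_lists_ge[of j] unfolding distrib_right by linarith
qed

text \<open>A degenerate set consists of an ordered spine of value one and an extension by two
  points. The spines number at most about \<open>2 * q ^ (2 * j - 1)\<close>, each with at most
  \<open>2 * q ^ 3\<close> extensions.\<close>

lemma card_degenerate_unit_sets_le:
  "card {e \<in> unit_sets j. degenerate j e} \<le> 4 * q ^ (2 * j + 2)"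
proof -
  have "{e \<in> unit_sets j. degenerate j e}
    \<subseteq> (\<lambda>(xs, a, b). insert a (insert b (set xs))) ` (SIGMA xs:unit_lists j. extensions xs)"
  proof
    fix e assume "e \<in> {e \<in> unit_sets j. degenerate j e}"
    then obtain S where e: "e \<subseteq> V" "card e = Suc (Suc j)" "Q e = 1"
      and S: "S \<subseteq> e" "card S = j" "Q S = 1"
      by (auto simp: unit_sets_def degenerate_def)
    have fin: "finite S"
      using S(1) e(1) finite_subset_V by blast
    have "card (e - S) = 2"
      using e S fin by (simp add: card_Diff_subset)
    then obtain a b where ab: "e - S = {a, b}" "a \<noteq> b"
      by (auto simp: card_2_iff)
    obtain xs where xs: "xs \<in> vlists j" "distinct xs" "set xs = S" "Q_list xs = Q S"
      using vlists_of_set[of S] S e(1) by auto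
    have e_eq: "e = set (a # b # xs)"
      using ab(1) S(1) xs(3) by auto
    have "distinct (a # b # xs)"
      using ab xs by auto
    hence "Q_list (a # b # xs) = 1"
      using Q_list_distinct e(3) e_eq by metis
    hence "(a, b) \<in> extensions xs"
      using e(1) e_eq by (auto simp: extensions_def)
    moreover have "xs \<in> unit_lists j"
      using xs S(3) by (simp add: unit_lists_def)
    ultimately show "e \<in> (\<lambda>(xs, a, b). insert a (insert b (set xs))) `
        (SIGMA xs:unit_lists j. extensions xs)"
      using e_eq by (intro image_eqI[of _ _ "(xs, a, b)"]) auto
  qed
  hence "card {e \<in> unit_sets j. degenerate j e} \<le> card (SIGMA xs:unit_lists j. extensions xs)"
    using finite_unit_lists finite_extensions by (intro surj_card_le) auto
  also have "\<dots> = (\<Sum>xs\<in>unit_lists j. card (extensions xs))"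
    using finite_unit_lists finite_extensions by simp
  also have "\<dots> \<le> (\<Sum>xs\<in>unit_lists j. 2 * q ^ 3)"
    by (intro sum_mono card_extensions(2)) (simp add: unit_lists_def vlists_def)
  \<comment> \<open>One factor \<open>q\<close> moves to the spines so that
    \<open>card_unit_lists_le\<close> applies.\<close>
  also have "\<dots> = q * card (unit_lists j) * (2 * q\<^sup>2)"
    by (simp add: eval_nat_numeral algebra_simps)
  also have "\<dots> \<le> 2 * q ^ (2 * j) * (2 * q\<^sup>2)"
    using card_unit_lists_le by (intro mult_right_mono) auto
  finally show ?thesis
    by (simp add: power_add power2_eq_square mult_ac)
qed

lemma sum_Diff_singleton_self:
  fixes e :: "('a \<times> 'a) set"
  assumes "finite e" "v \<in> e"
  shows "\<Sum>(e - {v}) = \<Sum>e + v"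
proof -
  have "\<Sum>e = v + \<Sum>(e - {v})"
    using assms by (simp add: sum.remove)
  hence "\<Sum>e + v = \<Sum>(e - {v}) + (v + v)"
    by (simp only: add_ac)
  thus ?thesis
    by (simp add: vec_add_self)
qed

text \<open>Deleting \<open>v\<close> from a zero-sum set leaves sum \<open>v\<close>, so the change
  of \<open>Q\<close> is \<open>wedge v v = 0\<close>. Hence all facets of a candidate
  \<open>(k + 1)\<close>-edge are candidate \<open>k\<close>-edges.\<close>

lemma zero_sum_sets_remove:
  assumes "e \<in> zero_sum_sets j" "v \<in> e"
  shows "e - {v} \<in> unit_sets j" "\<Sum>(e - {v}) = v"
proof -
  have e: "e \<subseteq> V" "finite e" "card e = Suc (Suc (Suc j))" "\<Sum>e = 0" "Q e = 1"
    using assms(1) finite_subset_V by (auto simp: zero_sum_sets_def)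
  show sum: "\<Sum>(e - {v}) = v"
    using sum_Diff_singleton_self[OF e(2) assms(2)] e(4) by simp
  have "Q e = Q (e - {v}) + wedge v (\<Sum>(e - {v}))"
    using Q_insert[of "e - {v}" v] assms(2) e(2) by (simp add: insert_absorb)
  hence "Q (e - {v}) = 1"
    by (simp only: sum wedge_self e(5)) simp
  thus "e - {v} \<in> unit_sets j"
    using e assms(2) by (auto simp: unit_sets_def)
qed

text \<open>This bounds the zero-sum sets from below: a unit set not containing its own sum is a
  zero-sum set minus one of its \<open>j + 3\<close> elements. The others form \<open>D\<close>, of
  lower order.\<close>

lemma card_unit_sets_le:
  "card (unit_sets j) \<le> Suc (Suc (Suc j)) * card (zero_sum_sets j) + q ^ (2 * j + 2)"
proof -
  define D where "D = {e \<in> unit_sets j. \<Sum>e \<in> e}"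
  \<comment> \<open>Removing the sum of \<open>e\<close> leaves a zero-sum set, in which one more
    element \<open>d\<close> is determined by the rest. Thus \<open>j + 1\<close> vectors encode
    \<open>e\<close>: its sum, then the rest without \<open>d\<close>, whose sum recovers
    \<open>d\<close>.\<close>
  have "D \<subseteq> (\<lambda>xs. insert (sum_list (tl xs)) (set xs)) ` vlists (Suc j)"
  proof
    fix e assume "e \<in> D"
    hence e: "e \<subseteq> V" "finite e" "card e = Suc (Suc j)" "\<Sum>e \<in> e"
      using finite_subset_V by (auto simp: D_def unit_sets_def)
    define g where "g = e - {\<Sum>e}"
    have g: "g \<subseteq> V" "finite g" "card g = Suc j" "\<Sum>g = 0"
      using e sum_Diff_singleton_self[OF e(2,4)] vec_add_self by (auto simp: g_def)
    have "g \<noteq> {}"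
      using g(3) by auto
    then obtain d where d: "d \<in> g"
      by blast
    have g_minus: "g - {d} \<subseteq> V"
      using g(1) by blast
    obtain xs where xs: "xs \<in> vlists (card (g - {d}))" "set xs = g - {d}"
        "sum_list xs = \<Sum>(g - {d})"
      by (rule vlists_of_set[OF g_minus])
    have "sum_list xs = d"
      using xs(3) sum_Diff_singleton_self[OF g(2) d] g(4) by simp
    moreover have "\<Sum>e # xs \<in> vlists (Suc j)"
    proof -
      have "card (g - {d}) = j"
        using g(2,3) d by simp
      moreover have "\<Sum>e \<in> V"
        using e(1,4) by blast
      ultimately show ?thesis
        using xs(1) by (simp add: vlists_def)
    qed
    moreover have "insert d (insert (\<Sum>e) (set xs)) = e"
    proof -
      have "insert d (set xs) = g"
        using d by (simp add: xs(2) insert_absorb)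
      moreover have "insert (\<Sum>e) g = e"
        using e(4) by (simp add: g_def insert_absorb)
      ultimately show ?thesis
        by (metis insert_commute)
    qed
    ultimately show "e \<in> (\<lambda>xs. insert (sum_list (tl xs)) (set xs)) ` vlists (Suc j)"
      by (intro image_eqI[of _ _ "\<Sum>e # xs"]) simp_all
  qed
  hence "card D \<le> card (vlists (Suc j))"
    using finite_vlists by (intro surj_card_le) auto
  hence D: "card D \<le> q ^ (2 * j + 2)"
    by (simp add: card_vlists)
  have "unit_sets j \<subseteq> (\<Union>e\<in>zero_sum_sets j. (\<lambda>v. e - {v}) ` e) \<union> D"
  proof
    fix f assume f: "f \<in> unit_sets j"
    show "f \<in> (\<Union>e\<in>zero_sum_sets j. (\<lambda>v. e - {v}) ` e) \<union> D"
    proof (cases "\<Sum>f \<in> f")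
      case False
      have f': "f \<subseteq> V" "finite f" "card f = Suc (Suc j)" "Q f = 1"
        using f finite_subset_V by (auto simp: unit_sets_def)
      have "insert (\<Sum>f) f \<in> zero_sum_sets j"
        using f' False sum_in_V[OF f'(1)]
        by (simp add: zero_sum_sets_def Q_insert wedge_self vec_add_self)
      moreover have "f = insert (\<Sum>f) f - {\<Sum>f}"
        using False by auto
      ultimately show ?thesis
        by blast
    qed (use f in \<open>simp add: D_def\<close>)
  qed
  moreover have finite_rem: "finite ((\<lambda>v. e - {v}) ` e)" if "e \<in> zero_sum_sets j" for e
    using that finite_subset_V by (auto simp: zero_sum_sets_def)
  moreover have "finite D"
    using finite_unit_sets by (simp add: D_def)
  ultimately have "card (unit_sets j) \<le> card ((\<Union>e\<in>zero_sum_sets j. (\<lambda>v. e - {v}) ` e) \<union> D)"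
    using finite_zero_sum_sets by (intro card_mono) auto
  also have "\<dots> \<le> card (\<Union>e\<in>zero_sum_sets j. (\<lambda>v. e - {v}) ` e) + card D"
    by (rule card_Un_le)
  also have "card (\<Union>e\<in>zero_sum_sets j. (\<lambda>v. e - {v}) ` e)
      \<le> (\<Sum>e\<in>zero_sum_sets j. card ((\<lambda>v. e - {v}) ` e))"
    by (rule card_UN_le[OF finite_zero_sum_sets])
  also have "\<dots> \<le> (\<Sum>e\<in>zero_sum_sets j. Suc (Suc (Suc j)))"
  proof (rule sum_mono)
    fix e assume "e \<in> zero_sum_sets j"
    thus "card ((\<lambda>v. e - {v}) ` e) \<le> Suc (Suc (Suc j))"
      using card_image_le[of e "\<lambda>v. e - {v}"] finite_subset_V by (auto simp: zero_sum_sets_def)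
  qed
  also have "\<dots> = Suc (Suc (Suc j)) * card (zero_sum_sets j)"
    by (simp only: sum_constant mult.commute of_nat_id)
  finally show ?thesis
    using D by linarith
qed

text \<open>Deleting an element outside the bad spine leaves a degenerate unit set, from which the
  zero-sum set is recovered by adjoining the sum.\<close>

lemma card_degenerate_zero_sum_sets_le:
  "card {e \<in> zero_sum_sets j. degenerate j e} \<le> 4 * q ^ (2 * j + 2)"
proof -
  have "{e \<in> zero_sum_sets j. degenerate j e}
    \<subseteq> (\<lambda>f. insert (\<Sum>f) f) ` {f \<in> unit_sets j. degenerate j f}"
  proof
    fix e assume "e \<in> {e \<in> zero_sum_sets j. degenerate j e}"
    then obtain S where e: "e \<in> zero_sum_sets j" and S: "S \<subseteq> e" "card S = j" "Q S = 1"
      by (auto simp: degenerate_def)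
    have "S \<noteq> e"
      using e S(2) by (auto simp: zero_sum_sets_def)
    then obtain c where c: "c \<in> e" "c \<notin> S"
      using S(1) by blast
    have "e - {c} \<in> {f \<in> unit_sets j. degenerate j f}"
      using zero_sum_sets_remove(1)[OF e c(1)] S c(2) by (auto simp: degenerate_def)
    moreover have "e = insert (\<Sum>(e - {c})) (e - {c})"
      using zero_sum_sets_remove(2)[OF e c(1)] c(1) by auto
    ultimately show "e \<in> (\<lambda>f. insert (\<Sum>f) f) ` {f \<in> unit_sets j. degenerate j f}"
      by blast
  qed
  hence "card {e \<in> zero_sum_sets j. degenerate j e} \<le> card {f \<in> unit_sets j. degenerate j f}"
    using finite_unit_sets by (intro surj_card_le) auto
  thus ?thesis
    using card_degenerate_unit_sets_le order_trans by blast
qed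

section \<open>The extremal complex\<close>

text \<open>All sets below size \<open>k = j + 2\<close> are included: this settles downward closure
  below that size, and they cannot serve as edges of a suspended cycle.\<close>

definition extremal_complex :: "nat \<Rightarrow> ('a \<times> 'a) hypergraph" where
  "extremal_complex j = Hypergraph V
     ({e. e \<subseteq> V \<and> card e < Suc (Suc j)}
      \<union> {e \<in> unit_sets j. \<not> degenerate j e} \<union> {e \<in> zero_sum_sets j. \<not> degenerate j e})"

lemma degenerate_mono: "degenerate j d \<Longrightarrow> d \<subseteq> e \<Longrightarrow> degenerate j e"
  by (auto simp: degenerate_def)

text \<open>The essential case is a proper subset of a zero-sum set. It lies in a facet, which is a
  unit set, and nondegeneracy passes to subsets.\<close>

lemma abstract_complex_extremal_complex: "abstract_complex (extremal_complex j)"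
proof -
  define E where "E = edges (extremal_complex j)"
  have E: "E = {e. e \<subseteq> V \<and> card e < Suc (Suc j)}
      \<union> {e \<in> unit_sets j. \<not> degenerate j e} \<union> {e \<in> zero_sum_sets j. \<not> degenerate j e}"
    by (simp add: E_def extremal_complex_def)
  have sub: "e \<subseteq> V" if "e \<in> E" for e
    using that by (auto simp: E unit_sets_def zero_sum_sets_def)
  have unit: "d \<in> E" if e: "e \<in> unit_sets j" "\<not> degenerate j e" and "d \<subseteq> e" for d e
  proof (cases "d = e")
    case False
    have "e \<subseteq> V" "card e = Suc (Suc j)"
      using e(1) by (auto simp: unit_sets_def)
    moreover from this have "card d < card e"
      using False \<open>d \<subseteq> e\<close> finite_subset_V by (intro psubset_card_mono) auto
    ultimately show ?thesis
      using \<open>d \<subseteq> e\<close> by (auto simp: E)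
  qed (use e in \<open>simp add: E\<close>)
  have down: "d \<in> E" if "e \<in> E" "d \<subseteq> e" for d e
  proof -
    consider "e \<subseteq> V" "card e < Suc (Suc j)" | "e \<in> unit_sets j" "\<not> degenerate j e"
      | "e \<in> zero_sum_sets j" "\<not> degenerate j e"
      using \<open>e \<in> E\<close> by (auto simp: E)
    thus ?thesis
    proof cases
      case 1
      moreover have "card d \<le> card e"
        using 1 that finite_subset_V by (intro card_mono) auto
      ultimately show ?thesis
        using that by (auto simp: E)
    next
      case 2
      thus ?thesis
        using unit that by blast
    next
      case 3
      show ?thesis
      proof (cases "d = e")
        case False
        then obtain v where v: "v \<in> e" "d \<subseteq> e - {v}"
          using \<open>d \<subseteq> e\<close> by blast
        thus ?thesis
          using unit[of "e - {v}"] zero_sum_sets_remove(1)[OF 3(1)] 3(2)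
            degenerate_mono[of j "e - {v}" e] by blast
      qed (use \<open>e \<in> E\<close> in simp)
    qed
  qed
  have "v \<in> \<Union>E" if "v \<in> V" for v
    using that by (intro UnionI[of "{v}"]) (auto simp: E)
  hence "\<Union>E = V"
    using sub by blast
  moreover have "{} \<in> E"
    by (simp add: E)
  moreover have "verts (extremal_complex j) = V"
    by (simp add: extremal_complex_def)
  ultimately show ?thesis
    using down finite_V unfolding abstract_complex_def E_def by metis
qed

text \<open>After translation by \<open>s\<close>, all four edges of a cycle have the same nonzero
  \<open>wedge\<close>. Then \<open>b + d\<close> is parallel to the translates of \<open>a\<close>
  and \<open>c\<close>, so these are parallel; hence \<open>a + c\<close> is parallel to the
  translates of \<open>a\<close> and \<open>b\<close>, forcing the edge \<open>ab\<close> to have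
  value 0.\<close>

lemma avoids_extremal_complex:
  "avoids_C4_suspension (Suc (Suc j)) (edges (extremal_complex j))"
  unfolding avoids_C4_suspension_def
proof (intro notI, elim exE conjE)
  fix S a b c d
  assume len: "length S = Suc (Suc j) - 2" and dist: "distinct (a # b # c # d # S)"
    and edges: "{insert a (insert b (set S)), insert b (insert c (set S)),
      insert c (insert d (set S)), insert d (insert a (set S))} \<subseteq> edges (extremal_complex j)"
  have card_S: "card (set S) = j"
    using len dist by (simp add: distinct_card)
  define s where "s = \<Sum>(set S)"
  have edge: "wedge (u + s) (v + s) = 1 + Q (set S) \<and> Q (set S) \<noteq> 1"
    if e: "insert u (insert v (set S)) \<in> edges (extremal_complex j)"
      and uv: "u \<noteq> v" "u \<notin> set S" "v \<notin> set S" for u v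
  proof -
    have "card (insert u (insert v (set S))) = Suc (Suc j)"
      using uv card_S by simp
    \<comment> \<open>The size \<open>j + 2\<close> excludes both the small sets and the zero-sum
      sets.\<close>
    hence "insert u (insert v (set S)) \<in> unit_sets j" "\<not> degenerate j (insert u (insert v (set S)))"
      using e by (auto simp: extremal_complex_def zero_sum_sets_def)
    moreover from this have "Q (set S) \<noteq> 1"
      using card_S by (auto simp: degenerate_def)
    ultimately have "Q (set S) + wedge (u + s) (v + s) = 1" "Q (set S) \<noteq> 1"
      using Q_insert2[of "set S" u v] uv by (auto simp: unit_sets_def s_def)
    thus ?thesis
      by (metis add.assoc add.commute add.right_neutral add_self)
  qed
  have ab: "wedge (a + s) (b + s) = 1 + Q (set S)" "1 + Q (set S) \<noteq> 0"
    and bc: "wedge (b + s) (c + s) = 1 + Q (set S)"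
    and cd: "wedge (c + s) (d + s) = 1 + Q (set S)"
    and da: "wedge (d + s) (a + s) = 1 + Q (set S)"
    using edge[of a b] edge[of b c] edge[of c d] edge[of d a] edges dist
    by (auto simp: add_eq_0_iff_eq)
  \<comment> \<open>The two copies of \<open>s\<close> cancel, so these are \<open>b + d\<close> and
    \<open>a + c\<close>, nonzero because opposite cycle vertices differ.\<close>
  define w u where "w = (b + s) + (d + s)" and "u = (a + s) + (c + s)"
  have "w \<noteq> 0" "u \<noteq> 0"
    using dist unfolding w_def u_def vec_add_eq_0_iff by auto
  moreover have "wedge w (a + s) = 0" "wedge w (c + s) = 0"
    unfolding w_def wedge_add_left[of "b + s"]
    using ab(1) bc cd da by (simp_all add: wedge_commute[of "b + s" "a + s"]
      wedge_commute[of "d + s" "c + s"] add_self)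
  ultimately have ac: "wedge (a + s) (c + s) = 0"
    using wedge_eq_0_trans by blast
  have "wedge u (a + s) = 0"
    unfolding u_def wedge_add_left[of "a + s"]
    using ac by (simp add: wedge_self wedge_commute[of "c + s"])
  moreover have "wedge u (b + s) = 0"
    unfolding u_def wedge_add_left[of "a + s"]
    using ab bc by (simp add: wedge_commute[of "c + s"] add_self)
  ultimately show False
    using wedge_eq_0_trans[OF \<open>u \<noteq> 0\<close>] ab by metis
qed

text \<open>Only edges of sizes \<open>k\<close> and \<open>k + 1\<close> are counted. The error
  constant is \<open>(1 + k^2) + (2 + k^2)\<close> from the two counts of candidates, plus 4 for the
  degenerate ones of each size.\<close>

lemma card_edges_extremal_complex:
  "(1 / fact (Suc (Suc j)) + 1 / fact (Suc (Suc (Suc j)))) * real q ^ (2 * j + 3)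
     - (2 * (Suc (Suc j))\<^sup>2 + 11) * real q ^ (2 * j + 2)
   \<le> real (card (edges (extremal_complex j)))"
proof -
  define M where "M = real q ^ (2 * j + 2)"
  define a :: real where "a = fact (Suc (Suc j))"
  define k :: real where "k = Suc (Suc j)"
  define A B where "A = {e \<in> unit_sets j. \<not> degenerate j e}"
    and "B = {e \<in> zero_sum_sets j. \<not> degenerate j e}"
  have fin: "finite A" "finite B"
    using finite_unit_sets finite_zero_sum_sets by (auto simp: A_def B_def)
  have "A \<inter> B = {}"
    by (auto simp: A_def B_def unit_sets_def zero_sum_sets_def)
  hence "card A + card B = card (A \<union> B)"
    using fin by (simp add: card_Un_disjoint)
  also have "\<dots> \<le> card (edges (extremal_complex j))"
  proof (rule card_mono)
    show "finite (edges (extremal_complex j))"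
      by (rule finite_subset[of _ "Pow V"])
        (auto simp: extremal_complex_def unit_sets_def zero_sum_sets_def finite_V)
    show "A \<union> B \<subseteq> edges (extremal_complex j)"
      by (auto simp: extremal_complex_def A_def B_def)
  qed
  finally have le: "real (card A) + real (card B) \<le> real (card (edges (extremal_complex j)))"
    by linarith
  have "unit_sets j = A \<union> {e \<in> unit_sets j. degenerate j e}"
    by (auto simp: A_def)
  hence "card (unit_sets j) \<le> card A + card {e \<in> unit_sets j. degenerate j e}"
    by (metis card_Un_le)
  hence "card (unit_sets j) \<le> card A + 4 * q ^ (2 * j + 2)"
    using card_degenerate_unit_sets_le[of j] by linarith
  hence A: "real (card (unit_sets j)) \<le> real (card A) + 4 * M"
    unfolding M_def of_nat_le_iff[where 'a = real, symmetric] by simp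
  have "zero_sum_sets j = B \<union> {e \<in> zero_sum_sets j. degenerate j e}"
    by (auto simp: B_def)
  hence "card (zero_sum_sets j) \<le> card B + card {e \<in> zero_sum_sets j. degenerate j e}"
    by (metis card_Un_le)
  hence "card (zero_sum_sets j) \<le> card B + 4 * q ^ (2 * j + 2)"
    using card_degenerate_zero_sum_sets_le[of j] by linarith
  hence B: "real (card (zero_sum_sets j)) \<le> real (card B) + 4 * M"
    unfolding M_def of_nat_le_iff[where 'a = real, symmetric] by simp
  have "real (card (unit_sets j))
      \<le> real (Suc (Suc (Suc j)) * card (zero_sum_sets j) + q ^ (2 * j + 2))"
    using card_unit_sets_le by (simp only: of_nat_le_iff)
  hence Z: "real (card (unit_sets j)) \<le> (k + 1) * real (card (zero_sum_sets j)) + M"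
    by (simp add: M_def k_def algebra_simps)
  have "real (q ^ (2 * j + 3)) \<le> real (fact (Suc (Suc j)) * card (unit_sets j)
      + (1 + (Suc (Suc j))\<^sup>2) * q ^ (2 * j + 2))"
    using card_unit_sets_ge by (simp only: of_nat_le_iff)
  hence U: "real q ^ (2 * j + 3) \<le> a * real (card (unit_sets j)) + (1 + k\<^sup>2) * M"
    by (simp only: M_def a_def k_def of_nat_add of_nat_mult of_nat_power of_nat_fact of_nat_1)
  have a: "a \<ge> 1" and k: "k \<ge> 0"
    by (simp_all only: a_def k_def fact_ge_1 of_nat_0_le_iff)
  have M: "M \<ge> 0"
    by (simp add: M_def)
  have "real q ^ (2 * j + 3) / a \<le> real (card (unit_sets j)) + (1 + k\<^sup>2) * M / a"
    using U a by (simp add: field_simps)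
  also have "(1 + k\<^sup>2) * M / a \<le> (1 + k\<^sup>2) * M"
    using a M by (simp add: divide_le_eq mult_left_mono[of 1 a, simplified] mult_nonneg_nonneg)
  finally have U': "real q ^ (2 * j + 3) / a \<le> real (card (unit_sets j)) + (1 + k\<^sup>2) * M"
    by simp
  have "real q ^ (2 * j + 3) / ((k + 1) * a) = real q ^ (2 * j + 3) / a / (k + 1)"
    by (simp add: mult.commute)
  also have "\<dots> \<le> ((k + 1) * real (card (zero_sum_sets j)) + (2 + k\<^sup>2) * M) / (k + 1)"
    using U' Z k by (intro divide_right_mono) (auto simp: algebra_simps)
  also have "\<dots> = real (card (zero_sum_sets j)) + (2 + k\<^sup>2) * M / (k + 1)"
    using k by (simp add: add_divide_distrib)
  also have "(2 + k\<^sup>2) * M / (k + 1) \<le> (2 + k\<^sup>2) * M"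
    using k M by (simp add: divide_le_eq mult_left_mono[of 1 "k + 1", simplified] mult_nonneg_nonneg)
  finally have Z': "real q ^ (2 * j + 3) / ((k + 1) * a)
      \<le> real (card (zero_sum_sets j)) + (2 + k\<^sup>2) * M"
    by simp
  have fact_eq: "fact (Suc (Suc (Suc j))) = (k + 1) * a"
    by (simp add: fact_Suc[of "Suc (Suc j)"] k_def a_def del: fact_Suc)
  have "(1 / a + 1 / ((k + 1) * a)) * real q ^ (2 * j + 3) - (2 * k\<^sup>2 + 11) * M
      \<le> real (card A) + real (card B)"
    using U' Z' A B by (simp add: algebra_simps)
  also note le
  finally show ?thesis
    by (simp only: fact_eq a_def [symmetric] M_def k_def of_nat_add of_nat_mult of_nat_power)
      simp
qed

end

section \<open>The extremal number\<close>

lemma finite_complex_sizes: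
  "finite {card (edges K) | K :: nat hypergraph.
     abstract_complex K \<and> card (verts K) = n \<and> complex_free F K}"
proof (rule finite_subset)
  show "{card (edges K) | K :: nat hypergraph.
     abstract_complex K \<and> card (verts K) = n \<and> complex_free F K} \<subseteq> {..2 ^ n}"
  proof
    fix x assume "x \<in> {card (edges K) | K :: nat hypergraph.
      abstract_complex K \<and> card (verts K) = n \<and> complex_free F K}"
    then obtain K :: "nat hypergraph" where K: "abstract_complex K" "card (verts K) = n"
      and x: "x = card (edges K)"
      by blast
    from K(1) have "edges K \<subseteq> Pow (verts K)" "finite (verts K)"
      by (auto simp: abstract_complex_def)
    hence "card (edges K) \<le> card (Pow (verts K))"
      by (intro card_mono) auto
    thus "x \<in> {..2 ^ n}"
      using \<open>finite (verts K)\<close> K(2) by (simp add: card_Pow x)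
  qed
qed simp

text \<open>The construction lives on pairs of field elements while \<open>ex_complex\<close> ranges
  over complexes on natural numbers, so it has to be transported along an injection.\<close>

lemma isomorphic_nat_complex:
  fixes K :: "'a hypergraph"
  assumes K: "abstract_complex K" and avoids: "avoids_C4_suspension k (edges K)"
  obtains K' :: "nat hypergraph" where "abstract_complex K'" "card (verts K') = card (verts K)"
    "avoids_C4_suspension k (edges K')" "card (edges K') = card (edges K)"
proof -
  have fin: "finite (verts K)" and sub: "\<And>e. e \<in> edges K \<Longrightarrow> e \<subseteq> verts K"
    using K by (auto simp: abstract_complex_def)
  obtain g :: "'a \<Rightarrow> nat" where g: "inj_on g (verts K)"
    using finite_imp_inj_to_nat_seg[OF fin] by blast
  define K' where "K' = Hypergraph (g ` verts K) ((`) g ` edges K)"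
  have "\<Union>(edges K') = verts K'"
    using K by (simp add: K'_def abstract_complex_def flip: image_Union)
  moreover have "{} \<in> edges K'"
    using K by (auto simp: K'_def abstract_complex_def)
  moreover have "d \<in> edges K'" if e: "e \<in> edges K'" "d \<subseteq> e" for d e
  proof -
    obtain e0 where e0: "e0 \<in> edges K" "e = g ` e0"
      using e(1) by (auto simp: K'_def)
    then obtain d0 where "d0 \<subseteq> e0" "d = g ` d0"
      using e(2) by (auto simp: subset_image_iff)
    thus ?thesis
      using K e0(1) by (auto simp: K'_def abstract_complex_def)
  qed
  moreover have "finite (verts K')"
    using fin by (simp add: K'_def)
  ultimately have "abstract_complex K'"
    unfolding abstract_complex_def by blast
  moreover have "card (verts K') = card (verts K)"
    using g by (simp add: K'_def card_image)
  moreover have "card (edges K') = card (edges K)"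
  proof -
    have "inj_on ((`) g) (edges K)"
      using sub g by (meson inj_onI inj_on_image_eq_iff)
    thus ?thesis
      by (simp add: K'_def card_image)
  qed
  moreover have "avoids_C4_suspension k (edges K')"
    unfolding avoids_C4_suspension_def
  proof (intro notI, elim exE conjE)
    fix S a b c d
    assume len: "length S = k - 2" and dist: "distinct (a # b # c # d # S)"
      and edges: "{insert a (insert b (set S)), insert b (insert c (set S)),
        insert c (insert d (set S)), insert d (insert a (set S))} \<subseteq> edges K'"
    define h where "h = inv_into (verts K) g"
    have pull: "h ` e \<in> edges K" if "e \<in> edges K'" for e
    proof -
      obtain e0 where e0: "e0 \<in> edges K" "e = g ` e0"
        using \<open>e \<in> edges K'\<close> by (auto simp: K'_def)
      hence "h ` e = e0"
        using g sub[OF e0(1)] by (simp add: h_def inv_into_image_cancel)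
      thus ?thesis
        using e0(1) by simp
    qed
    have "set (a # b # c # d # S) \<subseteq> \<Union>(edges K')"
      using edges by auto
    hence "set (a # b # c # d # S) \<subseteq> g ` verts K"
      using sub by (fastforce simp: K'_def)
    hence "inj_on h (set (a # b # c # d # S))"
      unfolding h_def by (rule inj_on_inv_into)
    hence "distinct (map h (a # b # c # d # S))"
      using dist by (simp only: distinct_map)
    hence "distinct (h a # h b # h c # h d # map h S)"
      by simp
    moreover have "insert (h u) (insert (h v) (set (map h S))) \<in> edges K"
      if "insert u (insert v (set S)) \<in> edges K'" for u v
      using pull[OF that] by simp
    ultimately show False
      using avoids_C4_suspensionD[OF avoids, of "map h S" "h a" "h b" "h c" "h d"] len edges
      by simp
  qed
  ultimately show thesis
    using that by blast
qed

lemma card_edges_le_ex_complex: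
  assumes "abstract_complex K" "card (verts K) = n" "avoids_C4_suspension k (edges K)"
  shows "card (edges K) \<le> ex_complex n (down_closure (suspension k (cycle_graph 4)))"
proof -
  obtain K' :: "nat hypergraph" where "abstract_complex K'" "card (verts K') = n"
    "avoids_C4_suspension k (edges K')" "card (edges K') = card (edges K)"
    using isomorphic_nat_complex[OF assms(1,3)] assms(2) by metis
  hence "card (edges K) \<in> {card (edges K) | K :: nat hypergraph. abstract_complex K
      \<and> card (verts K) = n \<and> complex_free (down_closure (suspension k (cycle_graph 4))) K}"
    by (intro CollectI exI[of _ K']) (simp add: complex_free_C4_suspension_iff)
  thus ?thesis
    unfolding ex_complex_def by (rule Max_ge[OF finite_complex_sizes])
qed

text \<open>The given complex \<open>K0\<close> guarantees that the set under \<open>Max\<close> is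
  nonempty, so that the maximum is attained.\<close>

lemma ex_complex_witness:
  assumes "abstract_complex K0" "card (verts K0) = n" "avoids_C4_suspension k (edges K0)"
  obtains K :: "nat hypergraph" where "abstract_complex K" "card (verts K) = n"
    "avoids_C4_suspension k (edges K)"
    "ex_complex n (down_closure (suspension k (cycle_graph 4))) = card (edges K)"
proof -
  define sizes where "sizes = {card (edges K) | K :: nat hypergraph. abstract_complex K
    \<and> card (verts K) = n \<and> complex_free (down_closure (suspension k (cycle_graph 4))) K}"
  obtain K' :: "nat hypergraph" where "abstract_complex K'" "card (verts K') = n"
    "avoids_C4_suspension k (edges K')"
    using isomorphic_nat_complex[OF assms(1,3)] assms(2) by metis
  hence "sizes \<noteq> {}"
    by (auto simp: sizes_def complex_free_C4_suspension_iff)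
  moreover have "finite sizes"
    unfolding sizes_def by (rule finite_complex_sizes)
  ultimately have "Max sizes \<in> sizes"
    by (rule Max_in[rotated])
  then obtain K :: "nat hypergraph" where "abstract_complex K" "card (verts K) = n"
    "complex_free (down_closure (suspension k (cycle_graph 4))) K" "Max sizes = card (edges K)"
    unfolding sizes_def by blast
  thus thesis
    using that by (simp add: complex_free_C4_suspension_iff ex_complex_def sizes_def)
qed

text \<open>Here \<open>n = 4 ^ m\<close> is \<open>q ^ 2\<close> with \<open>q = 2 ^ m\<close>. The
  constant is the sum of \<open>2 * k^2 + 11\<close> from the construction and \<open>k + 2\<close>
  from the upper bound.\<close>

lemma ex_complex_bounds:
  assumes "k \<ge> 2" "m > 0"
  shows "\<bar>real (ex_complex (4 ^ m) (down_closure (suspension k (cycle_graph 4))))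
      - (1 / fact k + 1 / fact (k + 1)) * (2 ^ m) ^ (2 * k - 1)\<bar>
    \<le> real (2 * k\<^sup>2 + k + 13) * (2 ^ m) ^ (2 * k - 2)"
proof -
  define q j where "q = (2 :: nat) ^ m" and "j = k - 2"
  have k: "k = Suc (Suc j)"
    using assms(1) by (simp add: j_def)
  define x where "x = ex_complex (4 ^ m) (down_closure (suspension k (cycle_graph 4)))"
  obtain F :: "bit alg_closure set" where F: "finite_char2_subfield F" "card F = q"
    using finite_char2_subfield_exists[OF assms(2)] by (auto simp: q_def)
  interpret finite_char2_subfield F
    by (rule F(1))
  have n: "4 ^ m = q\<^sup>2"
    by (simp add: q_def power2_eq_square flip: power_mult_distrib)
  have card: "card (verts (extremal_complex j)) = 4 ^ m"
    by (simp add: extremal_complex_def card_V F(2) n)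
  have avoids: "avoids_C4_suspension k (edges (extremal_complex j))"
    using avoids_extremal_complex by (simp add: k)
  have "card (edges (extremal_complex j)) \<le> x"
    unfolding x_def by (rule card_edges_le_ex_complex[OF abstract_complex_extremal_complex card avoids])
  moreover have "2 * j + 3 = 2 * k - 1" "2 * j + 2 = 2 * k - 2" "Suc k = k + 1"
    by (simp_all add: k)
  ultimately have lower: "(1 / fact k + 1 / fact (k + 1)) * real q ^ (2 * k - 1)
      - (2 * k\<^sup>2 + 11) * real q ^ (2 * k - 2) \<le> real x"
    using card_edges_extremal_complex[of j] F(2) unfolding k[symmetric] by simp
  obtain K :: "nat hypergraph" where K: "abstract_complex K" "card (verts K) = 4 ^ m"
    "avoids_C4_suspension k (edges K)" "x = card (edges K)"
    unfolding x_def by (rule ex_complex_witness[OF abstract_complex_extremal_complex card avoids])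
  have "C4_suspension_free_complex k q K"
    using K assms(1) n by unfold_locales (simp_all add: q_def)
  hence upper: "real x \<le> (1 / fact k + 1 / fact (k + 1)) * real q ^ (2 * k - 1)
      + (k + 2) * real q ^ (2 * k - 2)"
    unfolding K(4) by (rule C4_suspension_free_complex.card_edges_le)
  have le: "c * real q ^ (2 * k - 2) \<le> real (2 * k\<^sup>2 + k + 13) * real q ^ (2 * k - 2)"
    if "c \<le> real (2 * k\<^sup>2 + k + 13)" for c :: real
    using that by (rule mult_right_mono) simp
  have "real x - (1 / fact k + 1 / fact (k + 1)) * real q ^ (2 * k - 1)
      \<le> real (2 * k\<^sup>2 + k + 13) * real q ^ (2 * k - 2)"
    using upper le[of "k + 2"] by simp
  moreover have "(1 / fact k + 1 / fact (k + 1)) * real q ^ (2 * k - 1) - real x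
      \<le> real (2 * k\<^sup>2 + k + 13) * real q ^ (2 * k - 2)"
    using lower le[of "2 * k\<^sup>2 + 11"] by simp
  ultimately show ?thesis
    unfolding x_def by (simp add: q_def abs_le_iff)
qed

lemma four_power_powr: "k \<ge> 2 \<Longrightarrow> real (4 ^ m) powr (real k - 1 / 2) = (2 ^ m) ^ (2 * k - 1)"
proof -
  assume k: "k \<ge> 2"
  have four: "real (4 ^ m) = (2 ^ m) powr 2"
    by (simp add: powr_realpow power2_eq_square flip: power_mult_distrib)
  have "real (4 ^ m) powr (real k - 1 / 2) = (2 ^ m) powr (2 * (real k - 1 / 2))"
    by (simp only: four powr_powr)
  also have "2 * (real k - 1 / 2) = real (2 * k - 1)"
    using k by (simp add: of_nat_diff)
  finally show ?thesis
    by (simp add: powr_realpow)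
qed

theorem corollary10:
  fixes k :: nat
  assumes "k \<ge> 2"
  shows "\<exists>C::real. \<forall>n::nat. (\<exists>m::nat. n = 4 ^ m) \<longrightarrow>
    \<bar>real (ex_complex n (down_closure (suspension k (cycle_graph 4))))
       - (1 / fact k + 1 / fact (k + 1)) * real n powr (real k - 1/2)\<bar>
    \<le> C * real n ^ (k - 1)"
proof -
  define err where "err n = \<bar>real (ex_complex n (down_closure (suspension k (cycle_graph 4))))
       - (1 / fact k + 1 / fact (k + 1)) * real n powr (real k - 1/2)\<bar>" for n :: nat
  \<comment> \<open>For \<open>m = 0\<close> there is no field with \<open>2 ^ m\<close> elements;
    the term \<open>err 1\<close> in the constant covers this single case
    \<open>n = 1\<close>.\<close>
  have "err n \<le> max (err 1) (real (2 * k\<^sup>2 + k + 13)) * real n ^ (k - 1)" if n: "n = 4 ^ m" for n m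
  proof (cases "m = 0")
    case False
    have "real n ^ (k - 1) = (2 ^ m) ^ (2 * k - 2)"
    proof -
      have "real n = (2 ^ m)\<^sup>2"
        by (simp add: n power2_eq_square flip: power_mult_distrib)
      hence "real n ^ (k - 1) = (2 ^ m) ^ (2 * (k - 1))"
        by (simp only: power_mult)
      also have "2 * (k - 1) = 2 * k - 2"
        by simp
      finally show ?thesis .
    qed
    hence "err n \<le> real (2 * k\<^sup>2 + k + 13) * real n ^ (k - 1)"
      using ex_complex_bounds[OF assms, of m] False
      by (simp only: err_def n four_power_powr[OF assms] neq0_conv)
    also have "\<dots> \<le> max (err 1) (real (2 * k\<^sup>2 + k + 13)) * real n ^ (k - 1)"
      by (intro mult_right_mono) auto
    finally show ?thesis .
  qed (simp add: n)
  thus ?thesis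
    unfolding err_def by blast
qed

end
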